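(* A finite signed graph $\Sigma=(\Gamma,\sigma)$ without loops is line consistent if and only if it is balanced and has the following form: (1) Each connected component of the negative subgraph $\Sigma^-$ is a circle, a nontrivial path, or a single vertex. (2) A circle component of $\Sigma^-$ is a block of $\Sigma$, and each of its vertices is incident with at most one other edge, which must be a positive isthmus. (3) A nontrivial path component $P$ of $\Sigma^-$ either is an induced subgraph of $\Sigma$, or is all but one edge of a circle that is a block of $\Sigma$ whose remaining edge is positive. The endpoints of $P$ have degree at most $2$ in $\Sigma$. Each internal vertex of $P$ is incident with at most one other edge, which must be a positive isthmus. Furthermore, $P$ either (a) is part of a nontrivial block of $\Sigma$ (and then its endpoints necessarily have degree $2$); or (b) consists entirely of isthmi and its endpoints are not incident with any nontrivial block of $\Sigma$ (and then the second edge, if any, incident with an endpoint is necessarily a positive isthmus).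
   Context: A signed graph $\Sigma=(\Gamma,\sigma)$ is a graph $\Gamma$ (multiple edges allowed, no loops) with an edge signature $\sigma:E(\Gamma)\to\{+,-\}$. A circle is a cycle (in a multigraph two parallel edges form a circle of length 2). The sign of a circle is the product of its edge signs; $\Sigma$ is balanced if every circle is positive. The degree $d(v)$ is the number of edges incident with $v$. The negative subgraph $\Sigma^-$ is the spanning subgraph whose edges are the negative edges. A path is nontrivial if it has positive length. An isthmus is an edge belonging to no circle. A block is a connected graph with no cutpoint; a block of $\Sigma$ is a maximal block subgraph of $\Sigma$; a block is nontrivial if it contains a circle (the trivial blocks are isthmi and isolated vertices). The line graph $L(\Gamma)$ has the edges of $\Gamma$ as vertices, two such vertices being joined by one edge for each common endpoint (so parallel edges of $\Gamma$ give a double edge in $L(\Gamma)$). The line graph of $\Sigma$ is the vertex-signed graph $(L(\Gamma),\sigma)$, each vertex $e$ of $L(\Gamma)$ getting sign $\sigma(e)$. A vertex-signed graph is consistent if every circle has positive product of its vertex signs. $\Sigma$ is line consistent if $(L(\Gamma),\sigma)$ is consistent. *)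

theory Defs
  imports Main
begin

text \<open>
  An undirected multigraph has its own type of edges, each edge being mapped to its set of
  endpoints. Requiring that set to have exactly two elements excludes loops.
\<close>

record ('v, 'e) mgraph =
  verts :: "'v set"
  edges :: "'e set"
  ends  :: "'e \<Rightarrow> 'v set"

definition multigraph :: "('v, 'e) mgraph \<Rightarrow> bool" where
  "multigraph G \<longleftrightarrow> (\<forall>e \<in> edges G. ends G e \<subseteq> verts G \<and> card (ends G e) = 2)"

definition finite_multigraph :: "('v, 'e) mgraph \<Rightarrow> bool" where
  "finite_multigraph G \<longleftrightarrow> multigraph G \<and> finite (verts G) \<and> finite (edges G)"

text \<open>
  A subgraph keeps the whole function \<open>ends\<close>, also outside its edge set, so that two subgraphs
  of a graph are equal as records as soon as they have the same vertices and the same edges.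
\<close>

definition subgraph :: "('v, 'e) mgraph \<Rightarrow> ('v, 'e) mgraph \<Rightarrow> bool" where
  "subgraph H G \<longleftrightarrow>
     multigraph H \<and> verts H \<subseteq> verts G \<and> edges H \<subseteq> edges G \<and> ends H = ends G"

definition induced_subgraph :: "('v, 'e) mgraph \<Rightarrow> ('v, 'e) mgraph \<Rightarrow> bool" where
  "induced_subgraph H G \<longleftrightarrow>
     subgraph H G \<and> edges H = {e \<in> edges G. ends G e \<subseteq> verts H}"

definition incident_edges :: "('v, 'e) mgraph \<Rightarrow> 'v \<Rightarrow> 'e set" where
  "incident_edges G v = {e \<in> edges G. v \<in> ends G e}"

definition degree :: "('v, 'e) mgraph \<Rightarrow> 'v \<Rightarrow> nat" where
  "degree G v = card (incident_edges G v)"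

definition adj :: "('v, 'e) mgraph \<Rightarrow> 'v rel" where
  "adj G = {(x, y). \<exists>e \<in> edges G. ends G e = {x, y}}"

definition connected_graph :: "('v, 'e) mgraph \<Rightarrow> bool" where
  "connected_graph G \<longleftrightarrow>
     verts G \<noteq> {} \<and> (\<forall>x \<in> verts G. \<forall>y \<in> verts G. (x, y) \<in> (adj G)\<^sup>*)"

definition component :: "('v, 'e) mgraph \<Rightarrow> ('v, 'e) mgraph \<Rightarrow> bool" where
  "component H G \<longleftrightarrow>
     subgraph H G \<and> connected_graph H \<and>
     (\<forall>K. subgraph K G \<and> connected_graph K \<and> subgraph H K \<longrightarrow> K = H)"

text \<open>
  The cyclic sequences below have length at least 2; in length 2 the two edges are distinct and
  parallel.
\<close>

definition circle_graph :: "('v, 'e) mgraph \<Rightarrow> bool" where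
  "circle_graph C \<longleftrightarrow>
     (\<exists>vs es. 2 \<le> length vs \<and> length es = length vs \<and> distinct vs \<and> distinct es \<and>
        (\<forall>i < length vs. ends C (es ! i) = {vs ! i, vs ! (Suc i mod length vs)}) \<and>
        verts C = set vs \<and> edges C = set es)"

definition circle_of :: "('v, 'e) mgraph \<Rightarrow> ('v, 'e) mgraph \<Rightarrow> bool" where
  "circle_of C G \<longleftrightarrow> subgraph C G \<and> circle_graph C"

definition path_graph :: "('v, 'e) mgraph \<Rightarrow> 'v \<Rightarrow> 'v \<Rightarrow> bool" where
  "path_graph P u w \<longleftrightarrow>
     (\<exists>vs es. length vs = Suc (length es) \<and> distinct vs \<and> distinct es \<and>
        (\<forall>i < length es. ends P (es ! i) = {vs ! i, vs ! Suc i}) \<and>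
        verts P = set vs \<and> edges P = set es \<and> hd vs = u \<and> last vs = w)"

definition nontrivial_path :: "('v, 'e) mgraph \<Rightarrow> 'v \<Rightarrow> 'v \<Rightarrow> bool" where
  "nontrivial_path P u w \<longleftrightarrow> path_graph P u w \<and> edges P \<noteq> {}"

definition single_vertex :: "('v, 'e) mgraph \<Rightarrow> bool" where
  "single_vertex H \<longleftrightarrow> (\<exists>v. verts H = {v}) \<and> edges H = {}"

definition isthmus :: "('v, 'e) mgraph \<Rightarrow> 'e \<Rightarrow> bool" where
  "isthmus G e \<longleftrightarrow> e \<in> edges G \<and> \<not> (\<exists>C. circle_of C G \<and> e \<in> edges C)"

definition delete_vertex :: "('v, 'e) mgraph \<Rightarrow> 'v \<Rightarrow> ('v, 'e) mgraph" where
  "delete_vertex G v = G\<lparr>verts := verts G - {v}, edges := edges G - incident_edges G v\<rparr>"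

definition cutpoint :: "('v, 'e) mgraph \<Rightarrow> 'v \<Rightarrow> bool" where
  "cutpoint G v \<longleftrightarrow> v \<in> verts G \<and>
     (\<exists>x \<in> verts G - {v}. \<exists>y \<in> verts G - {v}.
        (x, y) \<in> (adj G)\<^sup>* \<and> (x, y) \<notin> (adj (delete_vertex G v))\<^sup>*)"

definition block_graph :: "('v, 'e) mgraph \<Rightarrow> bool" where
  "block_graph B \<longleftrightarrow> connected_graph B \<and> (\<forall>v. \<not> cutpoint B v)"

definition block_of :: "('v, 'e) mgraph \<Rightarrow> ('v, 'e) mgraph \<Rightarrow> bool" where
  "block_of B G \<longleftrightarrow>
     subgraph B G \<and> block_graph B \<and>
     (\<forall>K. subgraph K G \<and> block_graph K \<and> subgraph B K \<longrightarrow> K = B)"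

definition nontrivial_block_of :: "('v, 'e) mgraph \<Rightarrow> ('v, 'e) mgraph \<Rightarrow> bool" where
  "nontrivial_block_of B G \<longleftrightarrow> block_of B G \<and> (\<exists>C. circle_of C B)"

text \<open>A signed graph is a pair of a multigraph and an edge signature with values \<open>1\<close> and \<open>-1\<close>.\<close>

definition edge_signature :: "('v, 'e) mgraph \<Rightarrow> ('e \<Rightarrow> int) \<Rightarrow> bool" where
  "edge_signature G \<sigma> \<longleftrightarrow> (\<forall>e \<in> edges G. \<sigma> e = 1 \<or> \<sigma> e = -1)"

definition balanced :: "('v, 'e) mgraph \<Rightarrow> ('e \<Rightarrow> int) \<Rightarrow> bool" where
  "balanced G \<sigma> \<longleftrightarrow> (\<forall>C. circle_of C G \<longrightarrow> (\<Prod>e \<in> edges C. \<sigma> e) = 1)"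

definition negative_subgraph :: "('v, 'e) mgraph \<Rightarrow> ('e \<Rightarrow> int) \<Rightarrow> ('v, 'e) mgraph" where
  "negative_subgraph G \<sigma> = G\<lparr>edges := {e \<in> edges G. \<sigma> e = -1}\<rparr>"

text \<open>
  An edge of the line graph is a pair \<open>(v, {e, f})\<close>, where \<open>v\<close> is a common endpoint of the
  distinct edges \<open>e\<close> and \<open>f\<close>; parallel edges are thus joined twice.
\<close>

definition line_graph :: "('v, 'e) mgraph \<Rightarrow> ('e, 'v \<times> 'e set) mgraph" where
  "line_graph G =
     \<lparr>verts = edges G,
      edges = {(v, {e, f}) | v e f.
                 e \<in> edges G \<and> f \<in> edges G \<and> e \<noteq> f \<and> v \<in> ends G e \<inter> ends G f},
      ends = snd\<rparr>"

definition consistent :: "('v, 'e) mgraph \<Rightarrow> ('v \<Rightarrow> int) \<Rightarrow> bool" where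
  "consistent G \<mu> \<longleftrightarrow> (\<forall>C. circle_of C G \<longrightarrow> (\<Prod>v \<in> verts C. \<mu> v) = 1)"

definition line_consistent :: "('v, 'e) mgraph \<Rightarrow> ('e \<Rightarrow> int) \<Rightarrow> bool" where
  "line_consistent G \<sigma> \<longleftrightarrow> consistent (line_graph G) \<sigma>"

definition at_most_one_other_positive_isthmus ::
  "('v, 'e) mgraph \<Rightarrow> ('e \<Rightarrow> int) \<Rightarrow> ('v, 'e) mgraph \<Rightarrow> 'v \<Rightarrow> bool" where
  "at_most_one_other_positive_isthmus G \<sigma> H v \<longleftrightarrow>
     card (incident_edges G v - edges H) \<le> 1 \<and>
     (\<forall>e \<in> incident_edges G v - edges H. \<sigma> e = 1 \<and> isthmus G e)"

definition negative_components_condition :: "('v, 'e) mgraph \<Rightarrow> ('e \<Rightarrow> int) \<Rightarrow> bool" where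
  "negative_components_condition G \<sigma> \<longleftrightarrow>
     (\<forall>H. component H (negative_subgraph G \<sigma>) \<longrightarrow>
        circle_graph H \<or> (\<exists>u w. nontrivial_path H u w) \<or> single_vertex H)"

definition circle_components_condition :: "('v, 'e) mgraph \<Rightarrow> ('e \<Rightarrow> int) \<Rightarrow> bool" where
  "circle_components_condition G \<sigma> \<longleftrightarrow>
     (\<forall>C. component C (negative_subgraph G \<sigma>) \<and> circle_graph C \<longrightarrow>
        block_of C G \<and> (\<forall>v \<in> verts C. at_most_one_other_positive_isthmus G \<sigma> C v))"

definition negative_path_component ::
  "('v, 'e) mgraph \<Rightarrow> ('e \<Rightarrow> int) \<Rightarrow> ('v, 'e) mgraph \<Rightarrow> 'v \<Rightarrow> 'v \<Rightarrow> bool" where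
  "negative_path_component G \<sigma> P u w \<longleftrightarrow>
     component P (negative_subgraph G \<sigma>) \<and> nontrivial_path P u w"

definition in_nontrivial_block :: "('v, 'e) mgraph \<Rightarrow> ('v, 'e) mgraph \<Rightarrow> bool" where
  "in_nontrivial_block G P \<longleftrightarrow> (\<exists>B. nontrivial_block_of B G \<and> subgraph P B)"

definition isthmi_away_from_blocks ::
  "('v, 'e) mgraph \<Rightarrow> ('v, 'e) mgraph \<Rightarrow> 'v \<Rightarrow> 'v \<Rightarrow> bool" where
  "isthmi_away_from_blocks G P u w \<longleftrightarrow>
     (\<forall>e \<in> edges P. isthmus G e) \<and>
     (\<forall>B. nontrivial_block_of B G \<longrightarrow> u \<notin> verts B \<and> w \<notin> verts B)"

definition path_components_condition :: "('v, 'e) mgraph \<Rightarrow> ('e \<Rightarrow> int) \<Rightarrow> bool" where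
  "path_components_condition G \<sigma> \<longleftrightarrow>
     (\<forall>P u w. negative_path_component G \<sigma> P u w \<longrightarrow>
        (induced_subgraph P G \<or>
         (\<exists>C e. circle_graph C \<and> block_of C G \<and> e \<in> edges C \<and> \<sigma> e = 1 \<and>
                P = C\<lparr>edges := edges C - {e}\<rparr>)) \<and>
        degree G u \<le> 2 \<and> degree G w \<le> 2 \<and>
        (\<forall>v \<in> verts P - {u, w}. at_most_one_other_positive_isthmus G \<sigma> P v) \<and>
        (in_nontrivial_block G P \<or> isthmi_away_from_blocks G P u w))"

end

theory Submission
  imports Defs
begin

text \<open>
  A circle of the line graph is a closed walk that may pause at a vertex to touch edges there,
  with all edges distinct. Three edges at a vertex form such a circle, and so does a circle of the
  graph, possibly with one further touching edge inserted. Hence line consistency forces that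
  three edges at a vertex have positive product, that the graph is balanced, and that an edge
  meeting a circle without belonging to it is positive; in particular, if two negative edges meet,
  then there is at most one more edge at their vertex, a positive isthmus. The claimed form follows
  from these facts.

  Conversely, dropping the pauses from a circle of the line graph leaves a closed trail, which
  splits into circles of the graph; so its product is positive and none of its edges is an isthmus.
  A negative edge touched during a pause would share its vertex with two edges of the trail, but
  one of the two would be an isthmus by the structure conditions. If the trail is empty, all the
  edges are incident with one vertex.
\<close>

subsection \<open>Walks, paths and cycles\<close>

text \<open>The delicate length is 2. Two edges that share just one vertex are joined by a single
  line edge, which is no circle, so two negative edges may meet; only a third edge at their vertex,
  or a circle through it, brings a constraint. From three edges on, cyclic neighbours form different
  pairs, so repeating the touching vertex does no harm. In the converse everything rests on a vertex
  with three edges, one of them negative. The degree bound excludes endpoints of negative paths;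
  elsewhere the negative component takes at most two edges and at most one positive isthmus remains.
  So of the two edges beside the negative one, one is an isthmus. Components and blocks are defined
  by maximality, which is awkward to use directly. Most identifications therefore go through
  \<open>closed_subgraph_eq\<close>: in a connected graph, a nonempty subgraph containing all edges
  at its vertices is everything. The definitions list vertices and edges by index, while the proofs
  use lists of pairs (edge, vertex entered). With start \<open>x\<close>, the vertex sequence is
  \<open>x # map snd ps\<close>.\<close>

fun walk :: "('v, 'e) mgraph \<Rightarrow> 'v \<Rightarrow> ('e \<times> 'v) list \<Rightarrow> 'v \<Rightarrow> bool" where
  "walk G x [] y \<longleftrightarrow> x = y"
| "walk G x ((e, z) # ps) y \<longleftrightarrow> e \<in> edges G \<and> ends G e = {x, z} \<and> walk G z ps y"

lemma walk_append:
  "walk G x (ps @ qs) y \<longleftrightarrow> (\<exists>z. walk G x ps z \<and> walk G z qs y)"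
  by (induction ps arbitrary: x) auto

lemma walk_mono:
  assumes "walk H x ps y" "edges H \<subseteq> edges G" "ends H = ends G"
  shows "walk G x ps y"
  using assms(1) by (induction ps arbitrary: x) (use assms(2,3) in auto)

lemma walk_edges:
  assumes "walk G x ps y"
  shows "fst ` set ps \<subseteq> edges G"
  using assms by (induction ps arbitrary: x) fastforce+

lemma walk_ends:
  assumes "walk G x ps y" "e \<in> fst ` set ps"
  shows "ends G e \<subseteq> insert x (snd ` set ps)"
  using assms
proof (induction ps arbitrary: x)
  case Nil
  then show ?case by simp
next
  case (Cons p ps)
  obtain f z where p: "p = (f, z)" by (cases p)
  show ?case using Cons.prems Cons.IH[of z] unfolding p by (cases "e = f") auto
qed

lemma walk_snd_in_ends:
  assumes "walk G x ps y" "(e, z) \<in> set ps"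
  shows "z \<in> ends G e"
  using assms by (induction ps arbitrary: x) auto

lemma walk_last:
  assumes "walk G x ps y"
  shows "last (x # map snd ps) = y"
  using assms by (induction ps arbitrary: x) auto

lemma walk_end_mem:
  assumes "walk G x ps y" "ps \<noteq> []"
  shows "y \<in> snd ` set ps"
  using walk_last[OF assms(1)] assms(2) by (metis last_ConsR last_in_set list.map_disc_iff list.set_map)

lemma walk_verts:
  assumes "walk G x ps y" "multigraph G"
  shows "snd ` set ps \<subseteq> verts G"
  using walk_edges[OF assms(1)] walk_snd_in_ends[OF assms(1)] assms(2)
  by (fastforce simp: multigraph_def)

text \<open>The positional form of the recursion, as a bridge to \<open>circle_graph\<close> and
  \<open>path_graph\<close>.\<close>

lemma walk_iff_nth:
  "walk G x ps y \<longleftrightarrow> last (x # map snd ps) = y \<and>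
    (\<forall>i < length ps. fst (ps ! i) \<in> edges G \<and>
       ends G (fst (ps ! i)) = {(x # map snd ps) ! i, snd (ps ! i)})"
proof (induction ps arbitrary: x)
  case Nil
  then show ?case by auto
next
  case (Cons p ps)
  obtain e z where p: "p = (e, z)" by (cases p)
  show ?case
    unfolding p walk.simps Cons.IH by (auto simp: All_less_Suc2)
qed

text \<open>If the first edge recurred later, its end \<open>x\<close> would, by
  \<open>walk_ends\<close>, recur among the later vertices.\<close>

lemma walk_simple_distinct_edges:
  assumes "walk G x ps y" "distinct (x # map snd ps)"
  shows "distinct (map fst ps)"
  using assms
proof (induction ps arbitrary: x)
  case Nil
  then show ?case by simp
next
  case (Cons p ps)
  obtain e z where p: "p = (e, z)" by (cases p)
  have w: "walk G z ps y" "ends G e = {x, z}" using Cons.prems p by auto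
  have "e \<notin> fst ` set ps"
    using walk_ends[OF w(1), of e] w(2) Cons.prems(2) p by auto
  moreover have "distinct (map fst ps)"
    using Cons p w by auto
  ultimately show ?case using p by simp
qed

section \<open>Reachability and simple walks\<close>

lemma adj_sym: "sym (adj G)"
  by (auto simp: sym_def adj_def insert_commute)

lemma adj_rtrancl_sym: "(x, y) \<in> (adj G)\<^sup>* \<Longrightarrow> (y, x) \<in> (adj G)\<^sup>*"
  using sym_rtrancl[OF adj_sym] by (meson symD)

lemma adj_mono:
  assumes "edges H \<subseteq> edges G" "ends H = ends G"
  shows "(adj H)\<^sup>* \<subseteq> (adj G)\<^sup>*"
  by (rule rtrancl_mono) (use assms in \<open>auto simp: adj_def\<close>)

lemma walk_imp_adj:
  assumes "walk G x ps y"
  shows "(x, y) \<in> (adj G)\<^sup>*"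
  using assms
proof (induction ps arbitrary: x)
  case Nil
  then show ?case by simp
next
  case (Cons p ps)
  obtain e z where p: "p = (e, z)" by (cases p)
  have "(x, z) \<in> adj G" "(z, y) \<in> (adj G)\<^sup>*" using Cons p by (auto simp: adj_def)
  then show ?case by (rule converse_rtrancl_into_rtrancl)
qed

text \<open>Steps are prepended one at a time; if the new start already lies on the simple walk, the
  walk is cut at that occurrence instead of being extended.\<close>

lemma adj_imp_simple_walk:
  assumes "(x, y) \<in> (adj G)\<^sup>*"
  obtains ps where "walk G x ps y" "distinct (x # map snd ps)"
proof -
  have "\<exists>ps. walk G x ps y \<and> distinct (x # map snd ps)"
    using assms
  proof (induction rule: converse_rtrancl_induct)
    case base
    show ?case by (rule exI[of _ "[]"]) simp
  next
    case (step x z)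
    obtain e where e: "e \<in> edges G" "ends G e = {x, z}" using step by (auto simp: adj_def)
    obtain ps where ps: "walk G z ps y" "distinct (z # map snd ps)" using step by blast
    show ?case
    proof (cases "x \<in> set (z # map snd ps)")
      case False
      then show ?thesis using e ps by (intro exI[of _ "(e, z) # ps"]) auto
    next
      case True
      show ?thesis
      proof (cases "x = z")
        case True
        then show ?thesis using ps by blast
      next
        case False
        then obtain f where "(f, x) \<in> set ps" using True by auto
        then obtain as bs where s: "ps = as @ (f, x) # bs" by (meson split_list)
        then have "walk G x bs y" "distinct (x # map snd bs)"
          using ps by (auto simp: walk_append)
        then show ?thesis by blast
      qed
    qed
  qed
  then show thesis using that by blast
qed

lemma ends_obtain_other:
  assumes "multigraph G" "e \<in> edges G" "v \<in> ends G e"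
  obtains z where "ends G e = {v, z}" "z \<noteq> v"
proof -
  have "card (ends G e) = 2" using assms by (auto simp: multigraph_def)
  then obtain a b where "ends G e = {a, b}" "a \<noteq> b" by (auto simp: card_2_iff)
  then show thesis using that assms(3) by (metis insertE insert_commute singletonD)
qed

lemma multigraph_ends:
  assumes "multigraph G" "e \<in> edges G"
  shows "ends G e \<subseteq> verts G" "ends G e \<noteq> {}"
proof -
  have "ends G e \<subseteq> verts G" "card (ends G e) = 2" using assms by (simp_all add: multigraph_def)
  then show "ends G e \<subseteq> verts G" "ends G e \<noteq> {}" by auto
qed

lemma closed_walk_rotate:
  assumes "walk G x ps x" "v \<in> snd ` set ps"
  obtains as bs where "ps = as @ bs" "walk G v (bs @ as) v"
proof -
  obtain e where "(e, v) \<in> set ps" using assms by auto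
  then obtain as bs where s: "ps = as @ (e, v) # bs" by (meson split_list)
  then have "walk G v (bs @ as @ [(e, v)]) v"
    using assms(1) by (auto simp: walk_append)
  then show thesis using that[of "as @ [(e, v)]" bs] s by simp
qed

text \<open>In a closed walk \<open>map snd ps\<close> already contains the start, as its last
  entry, so it lists each vertex of the circle once. Distinctness of the edges matters at length 2,
  where it prevents walking one edge back and forth.\<close>

definition cycle :: "('v, 'e) mgraph \<Rightarrow> 'v \<Rightarrow> ('e \<times> 'v) list \<Rightarrow> bool" where
  "cycle G x ps \<longleftrightarrow> walk G x ps x \<and> ps \<noteq> [] \<and> distinct (map fst ps) \<and> distinct (map snd ps)"

lemma cycle_rotate:
  assumes "cycle G x ps" "v \<in> snd ` set ps"
  obtains qs where "cycle G v qs" "set qs = set ps"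
proof -
  obtain as bs where s: "ps = as @ bs" "walk G v (bs @ as) v"
    using closed_walk_rotate assms unfolding cycle_def by metis
  have "cycle G v (bs @ as)" using s assms(1) by (auto simp: cycle_def)
  then show thesis using that[of "bs @ as"] s by auto
qed

lemma cycle_mono:
  assumes "cycle H x ps" "subgraph H G"
  shows "cycle G x ps"
  using assms walk_mono unfolding cycle_def subgraph_def by metis

text \<open>Without loops the first step leaves \<open>v\<close>, so a different step must return.
  These two steps supply the edges at \<open>v\<close>, for circles and later for the stripped
  trail.\<close>

lemma closed_trail_shape:
  assumes "multigraph G" "walk G v ps v" "ps \<noteq> []"
  obtains e z ms f y where "ps = (e, z) # ms @ [(f, v)]" "ends G e = {v, z}"
    "walk G z ms y" "ends G f = {y, v}" "e \<in> edges G" "f \<in> edges G"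
proof -
  obtain e z qs where q: "ps = (e, z) # qs" using assms(3) by (metis list.exhaust surj_pair)
  have e: "e \<in> edges G" "ends G e = {v, z}" "walk G z qs v" using assms q by auto
  have "z \<noteq> v" using assms(1) e by (auto simp: multigraph_def)
  then have "qs \<noteq> []" using e by auto
  then obtain ms f v' where m: "qs = ms @ [(f, v')]" by (metis rev_exhaust surj_pair)
  then show thesis using that[of e z ms f] e q by (auto simp: walk_append)
qed

lemma cycle_shape:
  assumes "multigraph G" "cycle G v ps"
  obtains e z ms f y where "ps = (e, z) # ms @ [(f, v)]" "e \<noteq> f" "ends G e = {v, z}"
    "walk G z ms y" "ends G f = {y, v}" "e \<in> edges G" "f \<in> edges G" "v \<notin> insert z (snd ` set ms)"
proof -
  obtain e z ms f y where *: "ps = (e, z) # ms @ [(f, v)]" "ends G e = {v, z}"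
    "walk G z ms y" "ends G f = {y, v}" "e \<in> edges G" "f \<in> edges G"
    using closed_trail_shape[of G v ps] assms by (metis cycle_def)
  have "e \<noteq> f" "v \<notin> insert z (snd ` set ms)" using * assms(2) by (auto simp: cycle_def)
  then show thesis using that * by blast
qed

text \<open>Between its first and last step the cycle avoids \<open>v\<close>, so by
  \<open>walk_ends\<close> no edge in between is incident with \<open>v\<close>.\<close>

lemma cycle_incident:
  assumes "multigraph G" "cycle G v ps"
  obtains e f where "e \<noteq> f" "{g \<in> fst ` set ps. v \<in> ends G g} = {e, f}"
proof -
  obtain e z ms f y where *: "ps = (e, z) # ms @ [(f, v)]" "e \<noteq> f" "ends G e = {v, z}"
    "walk G z ms y" "ends G f = {y, v}" "v \<notin> insert z (snd ` set ms)"
    using cycle_shape[OF assms] by metis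
  have "v \<notin> ends G g" if "g \<in> fst ` set ms" for g
    using walk_ends[OF *(4) that] *(6) by auto
  then have "{g \<in> fst ` set ps. v \<in> ends G g} = {e, f}" using * by auto
  then show thesis using that * by blast
qed

section \<open>Translation between cycles as lists and circles as subgraphs\<close>

definition restrict :: "('v, 'e) mgraph \<Rightarrow> 'v set \<Rightarrow> 'e set \<Rightarrow> ('v, 'e) mgraph" where
  "restrict G V E = G\<lparr>verts := V, edges := E\<rparr>"

lemma restrict_simps [simp]:
  "verts (restrict G V E) = V" "edges (restrict G V E) = E" "ends (restrict G V E) = ends G"
  by (auto simp: restrict_def)

lemma subgraph_restrict:
  assumes "multigraph G" "V \<subseteq> verts G" "E \<subseteq> edges G" "\<And>e. e \<in> E \<Longrightarrow> ends G e \<subseteq> V"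
  shows "subgraph (restrict G V E) G"
  using assms by (auto simp: subgraph_def multigraph_def)

lemma mgraph_eqI:
  fixes G H :: "('v, 'e) mgraph"
  assumes "verts G = verts H" "edges G = edges H" "ends G = ends H"
  shows "G = H"
  using assms by (cases G, cases H) simp

lemma cycle_circle:
  assumes "multigraph G" "cycle G x ps"
  shows "circle_of (restrict G (snd ` set ps) (fst ` set ps)) G"
proof -
  let ?n = "length ps"
  \<comment> \<open>Step \<open>i\<close> enters vertex \<open>i\<close>, but
    \<open>circle_graph\<close> wants edge \<open>i\<close> to leave it, hence the shift by
    \<open>rotate1\<close>. At the last index it wraps to the first edge, which starts at
    \<open>x\<close>, the last vertex.\<close>
  let ?vs = "map snd ps" and ?es = "rotate1 (map fst ps)"
  have w: "walk G x ps x" and ne: "ps \<noteq> []" using assms by (auto simp: cycle_def)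
  have x: "x \<in> snd ` set ps" using walk_end_mem[OF w ne] .
  have sub: "subgraph (restrict G (snd ` set ps) (fst ` set ps)) G"
    using walk_ends[OF w] x
    by (intro subgraph_restrict assms walk_verts[OF w] walk_edges[OF w]) auto
  obtain e z ms f y where s: "ps = (e, z) # ms @ [(f, x)]"
    using cycle_shape[OF assms] by metis
  have nth: "ends G (fst (ps ! i)) = {(x # map snd ps) ! i, snd (ps ! i)}" if "i < ?n" for i
    using w that unfolding walk_iff_nth by auto
  have last: "?vs ! (?n - 1) = x" using s by (auto simp: nth_append)
  have step: "ends G (?es ! i) = {?vs ! i, ?vs ! (Suc i mod ?n)}" if "i < ?n" for i
  proof (cases "Suc i < ?n")
    case True
    then show ?thesis using nth[of "Suc i"] that by (simp add: nth_rotate1)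
  next
    case False
    then have i: "Suc i = ?n" "i = ?n - 1" using that by auto
    then have "?es ! i = fst (ps ! 0)" using that ne by (simp add: nth_rotate1 hd_conv_nth)
    then show ?thesis using nth[of 0] last i ne that by auto
  qed
  have "circle_graph (restrict G (snd ` set ps) (fst ` set ps))"
    unfolding circle_graph_def
    by (rule exI[of _ ?vs], rule exI[of _ ?es])
      (use step assms(2) s in \<open>auto simp: cycle_def\<close>)
  then show ?thesis using sub by (simp add: circle_of_def)
qed

lemma circle_cycle:
  assumes "circle_graph C" "v \<in> verts C"
  obtains ps where "cycle C v ps" "verts C = snd ` set ps" "edges C = fst ` set ps"
proof -
  obtain vs es where l: "2 \<le> length vs" "length es = length vs" and d: "distinct vs" "distinct es"
    and en: "\<And>i. i < length vs \<Longrightarrow> ends C (es ! i) = {vs ! i, vs ! (Suc i mod length vs)}"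
    and V: "verts C = set vs" and E: "edges C = set es"
    using assms(1) unfolding circle_graph_def by blast
  \<comment> \<open>The opposite shift: edge \<open>i\<close> leaves vertex \<open>i\<close> and
    must be paired with the vertex it enters.\<close>
  let ?ps = "zip es (rotate1 vs)"
  have ne: "vs \<noteq> []" using l by auto
  have m: "map fst ?ps = es" "map snd ?ps = rotate1 vs" using l by auto
  have lst: "last (rotate1 vs) = hd vs" using ne by (cases vs) auto
  have "walk C (hd vs) ?ps (hd vs)"
    unfolding walk_iff_nth m
  proof (intro conjI allI impI)
    show "last (hd vs # rotate1 vs) = hd vs" using lst ne by simp
  next
    fix i assume i: "i < length ?ps"
    then show "fst (?ps ! i) \<in> edges C" using E l by auto
    have "(hd vs # rotate1 vs) ! i = vs ! i"
    proof (cases i)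
      case 0
      then show ?thesis using ne by (simp add: hd_conv_nth)
    next
      case (Suc j)
      then show ?thesis using i l by (simp add: nth_rotate1)
    qed
    then show "ends C (fst (?ps ! i)) = {(hd vs # rotate1 vs) ! i, snd (?ps ! i)}"
      using en[of i] i l by (simp add: nth_rotate1)
  qed
  then have c: "cycle C (hd vs) ?ps" using m d ne l by (auto simp: cycle_def)
  have VE: "verts C = snd ` set ?ps" "edges C = fst ` set ?ps"
    using V E m by (metis list.set_map set_rotate1)+
  show thesis using cycle_rotate[OF c, of v] assms(2) VE that by metis
qed

lemma circle_of_subgraph: "circle_of C H \<Longrightarrow> subgraph H G \<Longrightarrow> circle_of C G"
  by (auto simp: circle_of_def subgraph_def)

lemma circle_of_multigraph: "circle_of C G \<Longrightarrow> multigraph C"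
  by (auto simp: circle_of_def subgraph_def)

lemma circle_incident:
  assumes "multigraph C" "circle_graph C" "v \<in> verts C"
  obtains e f where "e \<noteq> f" "incident_edges C v = {e, f}"
proof -
  obtain ps where p: "cycle C v ps" "edges C = fst ` set ps" using circle_cycle assms by metis
  show thesis using cycle_incident[OF assms(1) p(1)] that p(2) unfolding incident_edges_def by metis
qed

text \<open>The condition on \<open>f\<close> excludes returning along the only edge of a one-step
  walk; a parallel edge may still close it to a circle of length 2.\<close>

lemma simple_walk_close:
  assumes "walk G x ps y" "distinct (x # map snd ps)" "f \<in> edges G" "ends G f = {y, x}"
    "f \<notin> fst ` set ps"
  shows "cycle G x (ps @ [(f, x)])"
proof -
  have "walk G x (ps @ [(f, x)]) x" using assms(1,3,4) unfolding walk_append by auto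
  moreover have "distinct (map fst (ps @ [(f, x)]))"
    using walk_simple_distinct_edges[OF assms(1,2)] assms(5) by simp
  moreover have "distinct (map snd (ps @ [(f, x)]))" using assms(2) by simp
  ultimately show ?thesis by (simp add: cycle_def)
qed

subsection \<open>Components\<close>

text \<open>Closure spreads along connections: from a vertex of \<open>H\<close> every edge of
  \<open>K\<close> lies in \<open>H\<close>, and so does its other end. A global identification is
  thereby reduced to looking at the edges around single vertices.\<close>

lemma closed_subgraph_eq:
  fixes H K :: "('v, 'e) mgraph"
  assumes K: "multigraph K" "connected_graph K" and sub: "subgraph H K" and ne: "verts H \<noteq> {}"
    and closed: "\<And>v e. v \<in> verts H \<Longrightarrow> e \<in> incident_edges K v \<Longrightarrow> e \<in> edges H"
  shows "H = K"
proof -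
  have H: "multigraph H" "verts H \<subseteq> verts K" "edges H \<subseteq> edges K" "ends H = ends K"
    using sub by (auto simp: subgraph_def)
  obtain x where x: "x \<in> verts H" using ne by blast
  have reach: "y \<in> verts H" if "(x, y) \<in> (adj K)\<^sup>*" for y
    using that
  proof (induction rule: rtrancl_induct)
    case base
    show ?case by (rule x)
  next
    case (step y z)
    obtain e where e: "e \<in> edges K" "ends K e = {y, z}" using step by (auto simp: adj_def)
    then have "e \<in> edges H" using closed[of y e] step by (auto simp: incident_edges_def)
    then show ?case using H e by (auto simp: multigraph_def)
  qed
  have V: "verts K \<subseteq> verts H" using K(2) reach x H(2) unfolding connected_graph_def by blast
  have "edges K \<subseteq> edges H"
  proof
    fix e assume e: "e \<in> edges K"
    then have "ends K e \<noteq> {}" "ends K e \<subseteq> verts K"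
      using K(1) by (fastforce simp: multigraph_def)+
    then obtain v where "v \<in> verts H" "v \<in> ends K e" using V by blast
    then show "e \<in> edges H" using closed e by (auto simp: incident_edges_def)
  qed
  then show ?thesis using V H by (intro mgraph_eqI) auto
qed

lemma connected_graphI:
  assumes "x \<in> verts H" "\<And>y. y \<in> verts H \<Longrightarrow> (x, y) \<in> (adj H)\<^sup>*"
  shows "connected_graph H"
  unfolding connected_graph_def
proof (intro conjI ballI)
  fix y z assume "y \<in> verts H" "z \<in> verts H"
  then show "(y, z) \<in> (adj H)\<^sup>*"
    using assms(2) by (meson adj_rtrancl_sym rtrancl_trans)
qed (use assms(1) in blast)

lemma subgraph_antisym: "subgraph H K \<Longrightarrow> subgraph K H \<Longrightarrow> H = K"
  by (intro mgraph_eqI) (auto simp: subgraph_def)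

lemma subgraph_trans: "subgraph H K \<Longrightarrow> subgraph K G \<Longrightarrow> subgraph H G"
  by (auto simp: subgraph_def)

text \<open>Maximality in \<open>component\<close> shows neither existence nor closure under
  incident edges; this explicit model supplies both.\<close>

definition component_at :: "('v, 'e) mgraph \<Rightarrow> 'v \<Rightarrow> ('v, 'e) mgraph" where
  "component_at G x = restrict G {y \<in> verts G. (x, y) \<in> (adj G)\<^sup>*}
     {e \<in> edges G. \<exists>y \<in> ends G e. (x, y) \<in> (adj G)\<^sup>*}"

lemma component_at_simps [simp]:
  "verts (component_at G x) = {y \<in> verts G. (x, y) \<in> (adj G)\<^sup>*}"
  "edges (component_at G x) = {e \<in> edges G. \<exists>y \<in> ends G e. (x, y) \<in> (adj G)\<^sup>*}"
  "ends (component_at G x) = ends G"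
  by (auto simp: component_at_def)

lemma subgraph_component_at:
  assumes "multigraph G"
  shows "subgraph (component_at G x) G"
  unfolding component_at_def
proof (rule subgraph_restrict)
  fix e assume "e \<in> {e \<in> edges G. \<exists>y\<in>ends G e. (x, y) \<in> (adj G)\<^sup>*}"
  then obtain y where e: "e \<in> edges G" "y \<in> ends G e" "(x, y) \<in> (adj G)\<^sup>*" by blast
  obtain z where z: "ends G e = {y, z}" using ends_obtain_other[OF assms e(1,2)] .
  then have "(y, z) \<in> adj G" using e by (auto simp: adj_def)
  then have "(x, z) \<in> (adj G)\<^sup>*" using e(3) by (rule rtrancl_into_rtrancl[rotated])
  then show "ends G e \<subseteq> {y \<in> verts G. (x, y) \<in> (adj G)\<^sup>*}"
    using z e assms by (auto simp: multigraph_def)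
qed (use assms in auto)

lemma connected_component_at:
  assumes "multigraph G" "x \<in> verts G"
  shows "connected_graph (component_at G x)"
proof (rule connected_graphI)
  show "x \<in> verts (component_at G x)" using assms by simp
  fix y assume "y \<in> verts (component_at G x)"
  then have "(x, y) \<in> (adj G)\<^sup>*" by simp
  then show "(x, y) \<in> (adj (component_at G x))\<^sup>*"
  proof (induction rule: rtrancl_induct)
    case base
    show ?case by simp
  next
    case (step y z)
    then have "(y, z) \<in> adj (component_at G x)" by (auto simp: adj_def)
    with step.IH show ?case by (rule rtrancl_into_rtrancl)
  qed
qed

lemma connected_subgraph_component_at:
  assumes "subgraph K G" "connected_graph K" "x \<in> verts K"
  shows "subgraph K (component_at G x)"
proof -
  have r: "(x, y) \<in> (adj G)\<^sup>*" if "y \<in> verts K" for y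
    using assms that adj_mono[of K G] unfolding connected_graph_def subgraph_def by blast
  have "e \<in> edges (component_at G x)" if e: "e \<in> edges K" for e
  proof -
    have "ends K e \<subseteq> verts K" "ends K e \<noteq> {}"
      using assms(1) e by (fastforce simp: subgraph_def multigraph_def)+
    then show ?thesis using r assms(1) e by (auto simp: subgraph_def)
  qed
  then show ?thesis using r assms(1) by (auto simp: subgraph_def)
qed

lemma component_component_at:
  assumes "multigraph G" "x \<in> verts G"
  shows "component (component_at G x) G"
  unfolding component_def
proof (intro conjI allI impI)
  fix K assume K: "subgraph K G \<and> connected_graph K \<and> subgraph (component_at G x) K"
  then have "x \<in> verts K" using assms(2) by (auto simp: subgraph_def)
  then show "K = component_at G x" using K connected_subgraph_component_at subgraph_antisym by metis
qed (use assms in \<open>simp_all only: subgraph_component_at connected_component_at\<close>)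

lemma component_eq_component_at:
  assumes "multigraph G" "component H G" "x \<in> verts H"
  shows "H = component_at G x"
proof -
  have H: "subgraph H G" "connected_graph H"
    and max: "\<And>K. subgraph K G \<and> connected_graph K \<and> subgraph H K \<Longrightarrow> K = H"
    using assms(2) unfolding component_def by simp_all
  have "x \<in> verts G" using H(1) assms(3) by (auto simp: subgraph_def)
  then have "component_at G x = H"
    by (intro max conjI subgraph_component_at connected_component_at
        connected_subgraph_component_at assms H)
  then show ?thesis ..
qed

lemma component_incident:
  assumes "multigraph G" "component H G" "v \<in> verts H"
  shows "incident_edges H v = incident_edges G v"
  unfolding component_eq_component_at[OF assms] by (auto simp: incident_edges_def)

subsection \<open>Connected graphs of maximum degree 2\<close>

lemma walk_path_graph:
  assumes "walk G x ps y" "distinct (x # map snd ps)"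
    "verts P = set (x # map snd ps)" "edges P = fst ` set ps" "ends P = ends G"
  shows "path_graph P x y"
  unfolding path_graph_def
proof (rule exI[of _ "x # map snd ps"], rule exI[of _ "map fst ps"], intro conjI allI impI)
  fix i assume i: "i < length (map fst ps)"
  then show "ends P (map fst ps ! i) = {(x # map snd ps) ! i, (x # map snd ps) ! Suc i}"
    using assms(1,5) unfolding walk_iff_nth by simp
qed (use assms walk_simple_distinct_edges[OF assms(1,2)] walk_last[OF assms(1)] in auto)

lemma path_graph_walk:
  assumes "path_graph P x y"
  obtains ps where "walk P x ps y" "distinct (x # map snd ps)"
    "verts P = set (x # map snd ps)" "edges P = fst ` set ps"
proof -
  obtain vs es where l: "length vs = Suc (length es)" and d: "distinct vs"
    and en: "\<And>i. i < length es \<Longrightarrow> ends P (es ! i) = {vs ! i, vs ! Suc i}"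
    and V: "verts P = set vs" and E: "edges P = set es" and h: "hd vs = x" "last vs = y"
    using assms unfolding path_graph_def by blast
  let ?ps = "zip es (tl vs)"
  have m: "map fst ?ps = es" "map snd ?ps = tl vs" using l by auto
  have vs: "vs = x # tl vs" using l h by (cases vs) auto
  have "walk P x ?ps y"
    unfolding walk_iff_nth m
  proof (intro conjI allI impI)
    show "last (x # tl vs) = y" using vs h by simp
    fix i assume i: "i < length ?ps"
    then show "fst (?ps ! i) \<in> edges P" using E l by auto
    have "(x # tl vs) ! i = vs ! i" using vs by simp
    then show "ends P (fst (?ps ! i)) = {(x # tl vs) ! i, snd (?ps ! i)}"
      using en[of i] i l by (simp add: nth_tl)
  qed
  moreover have "distinct (x # map snd ?ps)" "verts P = set (x # map snd ?ps)"
    using vs d V m by metis+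
  moreover have "edges P = fst ` set ?ps" using E m by (metis list.set_map)
  ultimately show thesis using that by blast
qed

lemma path_graph_sym:
  assumes "path_graph P x y"
  shows "path_graph P y x"
proof -
  obtain vs es where l: "length vs = Suc (length es)" and d: "distinct vs" "distinct es"
    and en: "\<And>i. i < length es \<Longrightarrow> ends P (es ! i) = {vs ! i, vs ! Suc i}"
    and V: "verts P = set vs" and E: "edges P = set es" and h: "hd vs = x" "last vs = y"
    using assms unfolding path_graph_def by blast
  have "ends P (rev es ! i) = {rev vs ! i, rev vs ! Suc i}" if i: "i < length es" for i
  proof -
    have "length es - i = Suc (length es - Suc i)" using i by simp
    then show ?thesis using en[of "length es - Suc i"] i l by (simp add: rev_nth insert_commute)
  qed
  moreover have "vs \<noteq> []" using l by auto
  ultimately show ?thesis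
    unfolding path_graph_def using l d V E h
    by (intro exI[of _ "rev vs"] exI[of _ "rev es"]) (auto simp: hd_rev last_rev)
qed

section \<open>Edges at the endpoints and internal vertices of a path\<close>

lemma walk_start_incident:
  assumes "walk G x ps y" "distinct (x # map snd ps)" "ps \<noteq> []"
  obtains e where "{g \<in> fst ` set ps. x \<in> ends G g} = {e}"
proof -
  obtain e z qs where q: "ps = (e, z) # qs" using assms(3) by (metis list.exhaust surj_pair)
  have w: "walk G z qs y" "ends G e = {x, z}" using assms q by auto
  have "x \<notin> ends G g" if "g \<in> fst ` set qs" for g
    using walk_ends[OF w(1) that] assms(2) q by auto
  then have "{g \<in> fst ` set ps. x \<in> ends G g} = {e}" using q w by auto
  then show thesis using that by blast
qed

lemma walk_internal_incident:
  assumes "walk G x ps y" "distinct (x # map snd ps)" "v \<in> snd ` set ps" "v \<noteq> y"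
  obtains e f where "e \<noteq> f" "{g \<in> fst ` set ps. v \<in> ends G g} = {e, f}"
proof -
  obtain e where "(e, v) \<in> set ps" using assms(3) by auto
  then obtain as bs where s: "ps = as @ (e, v) # bs" by (meson split_list)
  obtain u where w: "walk G x as u" "ends G e = {u, v}" "walk G v bs y"
    using assms(1) s by (auto simp: walk_append)
  have bs: "bs \<noteq> []" "distinct (v # map snd bs)" using w assms(2,4) s by auto
  obtain f where f: "{g \<in> fst ` set bs. v \<in> ends G g} = {f}"
    using walk_start_incident[OF w(3) bs(2,1)] .
  have "v \<notin> ends G g" if "g \<in> fst ` set as" for g
    using walk_ends[OF w(1) that] assms(2) s by auto
  then have "{g \<in> fst ` set ps. v \<in> ends G g} = {e, f}" using s f w by auto
  moreover have "e \<noteq> f"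
    using walk_simple_distinct_edges[OF assms(1,2)] s f by auto
  ultimately show thesis using that by blast
qed

lemma path_start_incident:
  assumes "nontrivial_path P u w"
  obtains e where "incident_edges P u = {e}"
proof -
  have P: "path_graph P u w" "edges P \<noteq> {}" using assms by (auto simp: nontrivial_path_def)
  obtain ps where ps: "walk P u ps w" "distinct (u # map snd ps)" "edges P = fst ` set ps"
    using path_graph_walk[OF P(1)] .
  then have "ps \<noteq> []" using P(2) by auto
  then show thesis
    using walk_start_incident[OF ps(1,2)] ps(3) that unfolding incident_edges_def by metis
qed

lemma path_internal_incident:
  assumes "path_graph P u w" "v \<in> verts P - {u, w}"
  obtains e f where "e \<noteq> f" "incident_edges P v = {e, f}"
proof -
  obtain ps where ps: "walk P u ps w" "distinct (u # map snd ps)"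
    "verts P = set (u # map snd ps)" "edges P = fst ` set ps"
    using path_graph_walk[OF assms(1)] .
  then show thesis
    using walk_internal_incident[OF ps(1,2), of v] assms(2) that unfolding incident_edges_def by auto
qed

lemma nontrivial_path_sym: "nontrivial_path P u w \<Longrightarrow> nontrivial_path P w u"
  by (auto simp: nontrivial_path_def path_graph_sym)

lemma path_verts:
  assumes "path_graph P u w"
  shows "u \<in> verts P" "w \<in> verts P"
proof -
  obtain ps where ps: "walk P u ps w" "verts P = set (u # map snd ps)"
    using path_graph_walk[OF assms] .
  show "u \<in> verts P" "w \<in> verts P" using ps walk_last[OF ps(1)] last_in_set[of "u # map snd ps"] by auto
qed

lemma nontrivial_path_start: "nontrivial_path P u w \<Longrightarrow> u \<in> verts P"
  unfolding nontrivial_path_def using path_verts(1) by metis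

text \<open>Take a longest simple walk. Its ends have no neighbours off the walk, and its internal
  vertices already have two edges on it. If no further edge meets it, the walk is the whole graph; a
  further edge can only join the two ends, and the resulting circle is the whole graph by the degree
  bound.\<close>

lemma connected_max_degree_2:
  fixes H :: "('v, 'e) mgraph"
  assumes H: "multigraph H" "finite (verts H)" "connected_graph H"
    and deg: "\<And>v e f g. {e, f, g} \<subseteq> incident_edges H v \<Longrightarrow> e = f \<or> f = g \<or> e = g"
  shows "circle_graph H \<or> (\<exists>u w. path_graph H u w)"
proof -
  \<comment> \<open>The start vertex varies as well, so that maximality also forbids extending the
    walk at its front.\<close>
  define Q where "Q = (\<lambda>(x, ps). x \<in> verts H \<and> (\<exists>y. walk H x ps y) \<and> distinct (x # map snd ps))"
  obtain x0 where "x0 \<in> verts H" using H(3) by (auto simp: connected_graph_def)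
  then have "Q (x0, [])" by (auto simp: Q_def)
  moreover have "length (snd q) \<le> card (verts H)" if Qq: "Q q" for q
  proof -
    obtain x ps where q1: "q = (x, ps)" by (cases q)
    then obtain y where q: "q = (x, ps)" "walk H x ps y" "distinct (x # map snd ps)"
      using Qq by (auto simp: Q_def)
    have "length ps = card (set (map snd ps))" using q(3) distinct_card[of "map snd ps"] by simp
    also have "\<dots> \<le> card (verts H)" using walk_verts[OF q(2) H(1)] H(2) by (intro card_mono) auto
    finally show ?thesis using q by simp
  qed
  ultimately have "\<exists>q. Q q \<and> (\<forall>r. Q r \<longrightarrow> length (snd r) \<le> length (snd q))"
    by (intro ex_has_greatest_nat[of Q "(x0, [])" "\<lambda>q. length (snd q)" "Suc (card (verts H))"])
      (simp_all add: less_Suc_eq_le)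
  then obtain q where q: "Q q" "\<And>r. Q r \<Longrightarrow> length (snd r) \<le> length (snd q)" by metis
  obtain x ps where xps: "q = (x, ps)" by (cases q)
  then obtain y where xy: "x \<in> verts H" "walk H x ps y" "distinct (x # map snd ps)"
    using q(1) by (auto simp: Q_def)
  have max: "length ps' \<le> length ps" if "Q (x', ps')" for x' ps'
    using q(2)[OF that] xps by simp
  let ?V = "set (x # map snd ps)" and ?E = "fst ` set ps"
  have V: "?V \<subseteq> verts H" using walk_verts[OF xy(2) H(1)] xy by auto
  have y: "y \<in> ?V" using walk_last[OF xy(2)] last_in_set[of "x # map snd ps"] by auto
  have end_y: "z \<in> ?V" if g: "g \<in> edges H" "ends H g = {y, z}" for g z
  proof (rule ccontr)
    assume z: "z \<notin> ?V"
    have "walk H x (ps @ [(g, z)]) z" using xy g unfolding walk_append by auto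
    then have "Q (x, ps @ [(g, z)])" using z xy by (auto simp: Q_def)
    then show False using max by fastforce
  qed
  have end_x: "z \<in> ?V" if g: "g \<in> edges H" "ends H g = {x, z}" for g z
  proof (rule ccontr)
    assume z: "z \<notin> ?V"
    have "walk H z ((g, x) # ps) y" using xy g by auto
    moreover have "z \<in> verts H" using g H(1) by (auto simp: multigraph_def)
    ultimately have "Q (z, (g, x) # ps)" using z xy by (auto simp: Q_def)
    then show False using max by fastforce
  qed
  have internal: "g \<in> ?E" if v: "v \<in> ?V" "v \<noteq> x" "v \<noteq> y" and g: "g \<in> incident_edges H v" for g v
  proof -
    obtain e f where ef: "e \<noteq> f" "{g \<in> ?E. v \<in> ends H g} = {e, f}"
      using walk_internal_incident[OF xy(2,3), of v] v by auto
    then have "{e, f} \<subseteq> incident_edges H v"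
      using walk_edges[OF xy(2)] unfolding incident_edges_def by blast
    then have "g = e \<or> g = f" using deg[of e f g v] ef g by auto
    then show ?thesis using ef by blast
  qed
  show ?thesis
  proof (cases "\<exists>v \<in> ?V. \<exists>g \<in> incident_edges H v. g \<notin> ?E")
    case False
    let ?P = "restrict H ?V ?E"
    have "subgraph ?P H"
      using walk_ends[OF xy(2)] by (intro subgraph_restrict H V walk_edges[OF xy(2)]) auto
    then have "?P = H" using False by (intro closed_subgraph_eq H) auto
    moreover have "path_graph ?P x y" using walk_path_graph[OF xy(2,3)] by auto
    ultimately show ?thesis by metis
  next
    case True
    then obtain v g where v: "v \<in> ?V" "g \<in> incident_edges H v" "g \<notin> ?E" by blast
    have g: "g \<in> edges H" "v \<in> ends H g" using v by (auto simp: incident_edges_def)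
    obtain z where z: "ends H g = {v, z}" "z \<noteq> v" using ends_obtain_other[OF H(1) g] .
    \<comment> \<open>An edge off the walk cannot meet an internal vertex. Applied to both ends of
      \<open>g\<close>, this makes \<open>g\<close> join \<open>x\<close> and
      \<open>y\<close>.\<close>
    have vxy: "v = x \<or> v = y" using internal v by blast
    have "z \<in> ?V" using vxy end_x end_y g z by blast
    moreover have "g \<in> incident_edges H z" using g z by (auto simp: incident_edges_def)
    ultimately have "z = x \<or> z = y" using internal v by blast
    then have en: "ends H g = {y, x}" using vxy z by auto
    have c: "cycle H x (ps @ [(g, x)])" using simple_walk_close[OF xy(2,3) g(1) en v(3)] .
    let ?V = "snd ` set (ps @ [(g, x)])" and ?E = "fst ` set (ps @ [(g, x)])"
    let ?C = "restrict H ?V ?E"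
    have C: "circle_of ?C H" using cycle_circle[OF H(1) c] .
    have "?C = H"
    proof (intro closed_subgraph_eq H)
      show "subgraph ?C H" using C by (simp add: circle_of_def)
      fix v g assume v: "v \<in> verts ?C" "g \<in> incident_edges H v"
      obtain e f where ef: "e \<noteq> f" "incident_edges ?C v = {e, f}"
        using circle_incident[of ?C v] C v circle_of_multigraph[OF C] by (auto simp: circle_of_def)
      then have "e \<in> edges ?C" "f \<in> edges ?C" "v \<in> ends H e" "v \<in> ends H f"
        by (auto simp: incident_edges_def set_eq_iff)
      moreover have "edges ?C \<subseteq> edges H" using C by (simp add: circle_of_def subgraph_def)
      ultimately have "{e, f} \<subseteq> incident_edges H v" by (auto simp: incident_edges_def)
      then have "g = e \<or> g = f" using deg[of e f g v] ef v by auto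
      then show "g \<in> edges ?C" using \<open>e \<in> edges ?C\<close> \<open>f \<in> edges ?C\<close> by blast
    qed auto
    then show ?thesis using C by (metis circle_of_def)
  qed
qed

subsection \<open>Blocks\<close>

lemma circle_edge_incident:
  assumes "multigraph C" "circle_graph C" "v \<in> verts C"
  obtains e where "e \<in> edges C" "v \<in> ends C e"
proof -
  obtain e f where "incident_edges C v = {e, f}" using circle_incident[OF assms] .
  then have "e \<in> incident_edges C v" by simp
  then show thesis using that by (auto simp: incident_edges_def)
qed

lemma cycle_on_circle:
  assumes "multigraph G" "cycle G x ps"
  obtains C where "circle_of C G" "verts C = snd ` set ps" "edges C = fst ` set ps"
  using cycle_circle[OF assms] that by simp

text \<open>As \<open>v\<close> is no cutpoint, the other ends of \<open>e\<close> and
  \<open>f\<close> stay connected after its deletion; a simple walk there is closed to a circle by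
  \<open>e\<close> and \<open>f\<close>. This covers adjacent edges of a block, the only case
  required below.\<close>

lemma block_edges_on_circle:
  assumes K: "multigraph K" "block_graph K" and ef: "e \<noteq> f"
    and e: "e \<in> incident_edges K v" and f: "f \<in> incident_edges K v"
  obtains C where "circle_of C K" "e \<in> edges C" "f \<in> edges C"
proof -
  have E: "e \<in> edges K" "v \<in> ends K e" "f \<in> edges K" "v \<in> ends K f"
    using e f by (auto simp: incident_edges_def)
  obtain x where x: "ends K e = {v, x}" "x \<noteq> v" using ends_obtain_other[OF K(1) E(1,2)] .
  obtain y where y: "ends K f = {v, y}" "y \<noteq> v" using ends_obtain_other[OF K(1) E(3,4)] .
  have "ends K e \<subseteq> verts K" "ends K f \<subseteq> verts K" using E K(1) by (simp_all add: multigraph_def)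
  then have V: "v \<in> verts K" "x \<in> verts K - {v}" "y \<in> verts K - {v}" using x y by auto
  let ?D = "delete_vertex K v"
  have "(x, v) \<in> adj K" "(v, y) \<in> adj K" using x y E by (auto simp: adj_def insert_commute)
  then have "(x, y) \<in> (adj K)\<^sup>*" by (meson r_into_rtrancl rtrancl_trans)
  moreover have "\<not> cutpoint K v" using K(2) by (simp add: block_graph_def)
  \<comment> \<open>If \<open>e\<close> and \<open>f\<close> are parallel, then
    \<open>x = y\<close>, the walk is empty and the circle has length 2.\<close>
  ultimately have "(x, y) \<in> (adj ?D)\<^sup>*" using V unfolding cutpoint_def by blast
  then obtain ps where ps: "walk ?D x ps y" "distinct (x # map snd ps)"
    by (rule adj_imp_simple_walk)
  have D: "edges ?D \<subseteq> edges K" "ends ?D = ends K" by (auto simp: delete_vertex_def)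
  have av: "g \<in> edges K \<and> v \<notin> ends K g" if "g \<in> fst ` set ps" for g
    using walk_edges[OF ps(1)] that by (auto simp: delete_vertex_def incident_edges_def)
  have "v \<notin> snd ` set ps"
    using av walk_snd_in_ends[OF ps(1)] D(2) by fastforce
  then have "distinct (v # map snd ((e, x) # ps))" using ps(2) x(2) by auto
  moreover have "walk K v ((e, x) # ps) y" using walk_mono[OF ps(1) D] x(1) E(1) by simp
  moreover have "ends K f = {y, v}" using y(1) by auto
  moreover have "f \<notin> fst ` set ((e, x) # ps)" using av E(4) ef by auto
  ultimately have "cycle K v (((e, x) # ps) @ [(f, v)])" using E(3) simple_walk_close by metis
  then obtain C where "circle_of C K" "edges C = fst ` set (((e, x) # ps) @ [(f, v)])"
    using cycle_on_circle[OF K(1)] by metis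
  then show thesis using that by auto
qed

lemma walk_reach:
  assumes "walk G x ps y" "v \<in> snd ` set ps"
  shows "(x, v) \<in> (adj G)\<^sup>*"
proof -
  obtain e where "(e, v) \<in> set ps" using assms(2) by auto
  then obtain as bs where s: "ps = as @ (e, v) # bs" by (meson split_list)
  then have "walk G x (as @ [(e, v)]) v" using assms(1) by (auto simp: walk_append)
  then show ?thesis by (rule walk_imp_adj)
qed

lemma circle_verts_nonempty:
  assumes "circle_graph C"
  shows "verts C \<noteq> {}"
proof -
  obtain vs where "2 \<le> length vs" "verts C = set vs"
    using assms unfolding circle_graph_def by blast
  then show ?thesis by auto
qed

text \<open>Cutting the circle open at \<open>v\<close> leaves a walk through all other vertices
  that avoids \<open>v\<close>, so deleting \<open>v\<close> disconnects nothing.\<close>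

lemma circle_block_graph:
  assumes C: "multigraph C" "circle_graph C"
  shows "block_graph C"
  unfolding block_graph_def
proof (intro conjI allI notI)
  obtain v where v: "v \<in> verts C" using circle_verts_nonempty[OF C(2)] by blast
  obtain ps where ps: "cycle C v ps" "verts C = snd ` set ps" using circle_cycle[OF C(2) v] .
  show "connected_graph C"
  proof (rule connected_graphI[OF v])
    fix y assume "y \<in> verts C"
    then show "(v, y) \<in> (adj C)\<^sup>*" using ps walk_reach[of C v ps v y] by (simp add: cycle_def)
  qed
next
  fix v assume cut: "cutpoint C v"
  then have v: "v \<in> verts C" by (simp add: cutpoint_def)
  obtain ps where ps: "cycle C v ps" "verts C = snd ` set ps" using circle_cycle[OF C(2) v] .
  obtain e z ms f y where s: "ps = (e, z) # ms @ [(f, v)]" "walk C z ms y"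
    "v \<notin> insert z (snd ` set ms)"
    using cycle_shape[OF C(1) ps(1)] by metis
  let ?D = "delete_vertex C v"
  have "g \<in> edges ?D" if "g \<in> fst ` set ms" for g
    using walk_ends[OF s(2) that] walk_edges[OF s(2)] s(3) that
    by (auto simp: delete_vertex_def incident_edges_def)
  then have "walk ?D z ms y"
    using s(2) unfolding walk_iff_nth by (auto simp: delete_vertex_def)
  then have from_z: "(z, x) \<in> (adj ?D)\<^sup>*" if "x \<in> snd ` set ms" for x
    using that by (rule walk_reach)
  have "x = z \<or> x \<in> snd ` set ms" if "x \<in> verts C - {v}" for x
    using that unfolding ps(2) s(1) by auto
  then have "(z, x) \<in> (adj ?D)\<^sup>*" if "x \<in> verts C - {v}" for x
    using that from_z rtrancl.rtrancl_refl by metis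
  then have "(x, x') \<in> (adj ?D)\<^sup>*" if "x \<in> verts C - {v}" "x' \<in> verts C - {v}" for x x'
    using that by (meson adj_rtrancl_sym rtrancl_trans)
  then show False using cut unfolding cutpoint_def by blast
qed

lemma circle_of_block_graph:
  assumes "circle_of C G"
  shows "block_graph C"
  using assms circle_of_multigraph[OF assms] circle_block_graph unfolding circle_of_def by metis

text \<open>An edge of a larger block \<open>K\<close> at a vertex of \<open>C\<close> but off
  \<open>C\<close> would lie, together with an edge of \<open>C\<close>, on a circle of
  \<open>K\<close>; but it is an isthmus. So \<open>C\<close> is closed in \<open>K\<close>.\<close>

lemma circle_block_of:
  assumes G: "multigraph G" and C: "circle_of C G"
    and isth: "\<And>v e. v \<in> verts C \<Longrightarrow> e \<in> incident_edges G v \<Longrightarrow> e \<notin> edges C \<Longrightarrow> isthmus G e"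
  shows "block_of C G"
  unfolding block_of_def
proof (intro conjI allI impI)
  have mC: "multigraph C" "circle_graph C" "subgraph C G"
    using C circle_of_multigraph by (auto simp: circle_of_def)
  then show "subgraph C G" by simp
  show "block_graph C" using C by (rule circle_of_block_graph)
  fix K assume K: "subgraph K G \<and> block_graph K \<and> subgraph C K"
  have mK: "multigraph K" "connected_graph K" "ends K = ends G" "edges K \<subseteq> edges G"
    using K by (auto simp: subgraph_def block_graph_def)
  have "C = K"
  proof (rule closed_subgraph_eq)
    fix v e assume v: "v \<in> verts C" and e: "e \<in> incident_edges K v"
    show "e \<in> edges C"
    proof (rule ccontr)
      assume ne: "e \<notin> edges C"
      obtain f where f: "f \<in> edges C" "v \<in> ends C f"
        using circle_edge_incident[OF mC(1,2) v] .
      then have "f \<in> incident_edges K v" using K by (auto simp: incident_edges_def subgraph_def)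
      moreover have "e \<noteq> f" using ne f by auto
      ultimately obtain D where D: "circle_of D K" "e \<in> edges D"
        using block_edges_on_circle[OF mK(1) _ _ e] K by metis
      then have "circle_of D G" using K circle_of_subgraph by blast
      moreover have "isthmus G e" using isth v e ne mK by (auto simp: incident_edges_def)
      ultimately show False using D by (auto simp: isthmus_def)
    qed
  qed (use mK mC K circle_verts_nonempty in auto)
  then show "K = C" ..
qed

text \<open>Among the block subgraphs containing \<open>D\<close>, one with the largest total number
  of vertices and edges is maximal for inclusion, because an equal total forces both numbers to
  agree.\<close>

lemma ex_block_of:
  assumes G: "finite_multigraph G" and D: "subgraph D G" "block_graph D"
  obtains B where "block_of B G" "subgraph D B"
proof -
  let ?Q = "\<lambda>K. subgraph K G \<and> block_graph K \<and> subgraph D K"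
  let ?m = "\<lambda>K. card (verts K) + card (edges K)"
  have fin: "finite (verts K)" "finite (edges K)" if "subgraph K G" for K
    using that G finite_subset by (auto simp: subgraph_def finite_multigraph_def)
  have "\<forall>K. ?Q K \<longrightarrow> ?m K < Suc (?m G)"
    using G by (auto simp: subgraph_def finite_multigraph_def less_Suc_eq_le intro!: add_mono card_mono)
  moreover have "?Q D" using D by (auto simp: subgraph_def)
  ultimately have "\<exists>B. ?Q B \<and> (\<forall>K. ?Q K \<longrightarrow> ?m K \<le> ?m B)"
    by (rule ex_has_greatest_nat[rotated])
  then obtain B where B: "?Q B" "\<And>K. ?Q K \<Longrightarrow> ?m K \<le> ?m B" by metis
  have "K = B" if K: "subgraph K G" "block_graph K" "subgraph B K" for K
  proof -
    have "?m K \<le> ?m B" using B(2)[of K] B(1) K subgraph_trans by blast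
    moreover have s: "verts B \<subseteq> verts K" "edges B \<subseteq> edges K" "ends B = ends K"
      using K(3) by (auto simp: subgraph_def)
    moreover have "card (verts B) \<le> card (verts K)" "card (edges B) \<le> card (edges K)"
      using s fin[OF K(1)] by (auto intro: card_mono)
    ultimately have "card (verts B) = card (verts K)" "card (edges B) = card (edges K)" by auto
    then have "verts B = verts K" "edges B = edges K"
      using card_subset_eq[OF fin(1)[OF K(1)] s(1)] card_subset_eq[OF fin(2)[OF K(1)] s(2)] by simp_all
    then show ?thesis using s by (intro mgraph_eqI) auto
  qed
  then have "block_of B G" using B(1) by (auto simp: block_of_def)
  then show thesis using that B(1) by blast
qed

text \<open>If another edge meets \<open>e\<close>, the two lie on a common circle. Otherwise
  \<open>e\<close> with its ends is all of \<open>B\<close>, whereas the circle \<open>D\<close>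
  needs two edges.\<close>

lemma block_edge_on_circle:
  assumes B: "multigraph B" "block_graph B" and D: "circle_of D B" and e: "e \<in> edges B"
  obtains C where "circle_of C B" "e \<in> edges C"
proof (cases "\<exists>v \<in> ends B e. \<exists>f \<in> incident_edges B v. f \<noteq> e")
  case True
  then obtain v f where vf: "v \<in> ends B e" "f \<in> incident_edges B v" "f \<noteq> e" by blast
  then have "e \<in> incident_edges B v" using e by (auto simp: incident_edges_def)
  then show thesis using block_edges_on_circle[OF B vf(3) vf(2)] that by metis
next
  case False
  let ?H = "restrict B (ends B e) {e}"
  have "ends B e \<noteq> {}" "ends B e \<subseteq> verts B" using multigraph_ends[OF B(1) e] by simp_all
  then have "?H = B"
    using B e False by (intro closed_subgraph_eq subgraph_restrict) (auto simp: block_graph_def)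
  then have *: "edges B = {e}" by (metis restrict_simps(2))
  have mD: "multigraph D" "circle_graph D" "edges D \<subseteq> edges B"
    using D by (auto simp: circle_of_def subgraph_def)
  obtain v where "v \<in> verts D" using circle_verts_nonempty[OF mD(2)] by blast
  then obtain f g where "f \<noteq> g" "incident_edges D v = {f, g}"
    using circle_incident[OF mD(1,2)] by metis
  then have "f \<noteq> g" "f \<in> edges D" "g \<in> edges D" by (auto simp: incident_edges_def set_eq_iff)
  then show thesis using * mD(3) by auto
qed

text \<open>A vertex without edges would be all of the connected graph \<open>B\<close>, leaving no
  edges for \<open>D\<close>.\<close>

lemma block_vertex_on_circle:
  assumes B: "multigraph B" "block_graph B" and D: "circle_of D B" and v: "v \<in> verts B"
  obtains C where "circle_of C B" "v \<in> verts C"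
proof (cases "incident_edges B v = {}")
  case False
  then obtain e where e: "e \<in> edges B" "v \<in> ends B e" by (auto simp: incident_edges_def)
  obtain C where C: "circle_of C B" "e \<in> edges C" using block_edge_on_circle[OF B D e(1)] .
  then have "v \<in> verts C" using e by (fastforce simp: circle_of_def subgraph_def multigraph_def)
  then show thesis using that C by blast
next
  case True
  let ?H = "restrict B {v} {}"
  have "?H = B"
    using B v True by (intro closed_subgraph_eq subgraph_restrict) (auto simp: block_graph_def)
  then have *: "edges B = {}" by (metis restrict_simps(2))
  have mD: "multigraph D" "circle_graph D" "edges D \<subseteq> edges B"
    using D by (auto simp: circle_of_def subgraph_def)
  obtain w where "w \<in> verts D" using circle_verts_nonempty[OF mD(2)] by blast
  then show thesis using circle_edge_incident[OF mD(1,2)] mD(3) * by blast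
qed

subsection \<open>Circles of the line graph\<close>

text \<open>Unlike in a walk, a step of a line walk may stay at its vertex while touching an edge there.\<close>

fun line_walk :: "('v, 'e) mgraph \<Rightarrow> 'v \<Rightarrow> ('e \<times> 'v) list \<Rightarrow> 'v \<Rightarrow> bool" where
  "line_walk G x [] y \<longleftrightarrow> x = y"
| "line_walk G x ((e, z) # ps) y \<longleftrightarrow>
     e \<in> edges G \<and> x \<in> ends G e \<and> z \<in> ends G e \<and> line_walk G z ps y"

lemma walk_line_walk: "walk G x ps y \<Longrightarrow> line_walk G x ps y"
  by (induction ps arbitrary: x) auto

lemma line_walk_iff_nth:
  "line_walk G x ps y \<longleftrightarrow> last (x # map snd ps) = y \<and>
    (\<forall>i < length ps. fst (ps ! i) \<in> edges G \<and> (x # map snd ps) ! i \<in> ends G (fst (ps ! i)) \<and>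
       snd (ps ! i) \<in> ends G (fst (ps ! i)))"
proof (induction ps arbitrary: x)
  case Nil
  then show ?case by auto
next
  case (Cons p ps)
  obtain e z where p: "p = (e, z)" by (cases p)
  show ?case
    unfolding p line_walk.simps Cons.IH by (auto simp: All_less_Suc2)
qed

lemma line_graph_simps [simp]:
  "verts (line_graph G) = edges G" "ends (line_graph G) = snd"
  "(v, {e, f}) \<in> edges (line_graph G) \<longleftrightarrow>
     e \<in> edges G \<and> f \<in> edges G \<and> e \<noteq> f \<and> v \<in> ends G e \<and> v \<in> ends G f"
  by (auto simp: line_graph_def doubleton_eq_iff)

text \<open>The edges of the walk, in cyclic order, are the vertices of a circle of the line graph.
  The length condition makes its line edges distinct: with two edges both line edges join the same
  pair, and only their vertex labels can tell them apart.\<close>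

lemma line_consistent_line_walk:
  assumes lc: "line_consistent G \<sigma>" and w: "line_walk G x ps x" and d: "distinct (map fst ps)"
    and l: "3 \<le> length ps \<or> length ps = 2 \<and> distinct (map snd ps)"
  shows "(\<Prod>e \<in> fst ` set ps. \<sigma> e) = 1"
proof -
  define n where "n = length ps"
  define E where "E = (\<lambda>i. fst (ps ! i))"
  define X where "X = (\<lambda>i. snd (ps ! i))"
  \<comment> \<open>The line edge after position \<open>i\<close>, labelled by the vertex where edge
    \<open>i\<close> hands over to its cyclic successor.\<close>
  define le where "le = (\<lambda>i. (X i, {E i, E (Suc i mod n)}))"
  have n: "2 \<le> n" using l by (auto simp: n_def)
  have E: "E i \<in> edges G" "X i \<in> ends G (E i)" if "i < n" for i
    using w that unfolding line_walk_iff_nth E_def X_def n_def by auto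
  have next_end: "X i \<in> ends G (E (Suc i mod n))" if i: "i < n" for i
  proof (cases "Suc i < n")
    case True
    have "(x # map snd ps) ! Suc i \<in> ends G (E (Suc i))"
      using w True unfolding line_walk_iff_nth E_def n_def by blast
    then show ?thesis using True i by (simp add: X_def n_def)
  next
    case False
    then have "i = n - 1" using i by simp
    moreover have "ps \<noteq> []" using n by (auto simp: n_def)
    moreover have "last (x # map snd ps) = x" using w unfolding line_walk_iff_nth by blast
    \<comment> \<open>At the wrap-around closedness enters: the last handover vertex is the start
      \<open>x\<close>, an end of the edge \<open>E 0\<close>.\<close>
    ultimately have "X i = x" by (simp add: X_def n_def last_map last_conv_nth)
    moreover have "x \<in> ends G (E 0)"
      using w n unfolding line_walk_iff_nth E_def n_def by force
    moreover have "Suc i = n" using False i by simp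
    then have "Suc i mod n = 0" by simp
    ultimately show ?thesis by simp
  qed
  have inj: "E i = E j \<longleftrightarrow> i = j" if "i < n" "j < n" for i j
    using nth_eq_iff_index_eq[OF d, of i j] that by (simp add: E_def n_def)
  have mod: "Suc i mod n < n" "Suc i mod n \<noteq> i" if "i < n" for i
    using that n by (auto simp: mod_Suc)
  have le_inj: "i = j" if ij: "i < n" "j < n" and eq: "le i = le j" for i j
  proof (rule ccontr)
    assume ne: "i \<noteq> j"
    have "{E i, E (Suc i mod n)} = {E j, E (Suc j mod n)}" "X i = X j"
      using eq by (auto simp: le_def)
    \<comment> \<open>Equal pairs at different positions make each position the cyclic successor of
      the other, which forces \<open>n = 2\<close>.\<close>
    then have "i = Suc j mod n" "j = Suc i mod n"
      using ne inj ij mod by (auto simp: doubleton_eq_iff)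
    moreover have "Suc k mod n = (if Suc k = n then 0 else Suc k)" if "k < n" for k
      using that by (simp add: mod_Suc)
    ultimately have "n = 2" using ij n ne by (auto split: if_splits)
    then have "distinct (map snd ps)" using l by (auto simp: n_def)
    then show False using \<open>X i = X j\<close> ne ij nth_eq_iff_index_eq[of "map snd ps" i j]
      by (simp add: X_def n_def)
  qed
  let ?C = "\<lparr>verts = fst ` set ps, edges = le ` {..<n}, ends = snd\<rparr>"
  have V: "fst ` set ps = E ` {..<n}"
    by (auto simp: E_def n_def set_conv_nth image_iff)
  have "circle_graph ?C"
    unfolding circle_graph_def
  proof (rule exI[of _ "map fst ps"], rule exI[of _ "map le [0..<n]"], intro conjI allI impI)
    show "distinct (map le [0..<n])"
      using le_inj by (auto simp: distinct_map inj_on_def)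
    fix i assume "i < length (map fst ps)"
    then show "ends ?C (map le [0..<n] ! i) =
      {map fst ps ! i, map fst ps ! (Suc i mod length (map fst ps))}"
      using mod(1)[of i] by (simp add: le_def E_def n_def)
  qed (use n d in \<open>auto simp: n_def atLeast0LessThan\<close>)
  moreover have "subgraph ?C (line_graph G)"
    unfolding subgraph_def multigraph_def
  proof (intro conjI ballI)
    fix h assume "h \<in> edges ?C"
    then obtain i where i: "i < n" "h = le i" by auto
    then show "ends ?C h \<subseteq> verts ?C" using mod(1)[of i] unfolding V by (simp add: le_def V)
    have "E i \<noteq> E (Suc i mod n)" using inj mod i by metis
    then show "card (ends ?C h) = 2" using i by (simp add: le_def)
  next
    show "edges ?C \<subseteq> edges (line_graph G)"
    proof
      fix h assume "h \<in> edges ?C"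
      then obtain i where i: "i < n" "h = le i" by auto
      moreover have "E i \<noteq> E (Suc i mod n)" using inj mod i by metis
      ultimately show "h \<in> edges (line_graph G)"
        using E next_end mod(1) by (simp add: le_def)
    qed
  qed (use E(1) in \<open>auto simp: V\<close>)
  ultimately have "circle_of ?C (line_graph G)" by (simp add: circle_of_def)
  then show ?thesis using lc unfolding line_consistent_def consistent_def by fastforce
qed

text \<open>The label of a line edge is a common end of the two edges it joins, so each vertex of
  the line circle, paired with the label of the line edge leaving it, is a step. The walk starts at
  the label of the last line edge.\<close>

lemma line_graph_circle_walk:
  assumes "circle_of D (line_graph G)"
  obtains x ps where "line_walk G x ps x" "distinct (map fst ps)" "verts D = fst ` set ps"
    "2 \<le> length ps" "length ps = 2 \<longrightarrow> distinct (map snd ps)"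
proof -
  obtain vs es where l: "2 \<le> length vs" "length es = length vs" and d: "distinct vs" "distinct es"
    and en: "\<And>i. i < length vs \<Longrightarrow> ends D (es ! i) = {vs ! i, vs ! (Suc i mod length vs)}"
    and V: "verts D = set vs" and E: "edges D = set es"
    using assms unfolding circle_graph_def circle_of_def by blast
  have sub: "verts D \<subseteq> edges G" "edges D \<subseteq> edges (line_graph G)" "ends D = snd"
    using assms by (auto simp: circle_of_def subgraph_def)
  let ?n = "length vs"
  let ?ps = "zip vs (map fst es)"
  let ?x = "fst (es ! (?n - 1))"
  have m: "map fst ?ps = vs" "map snd ?ps = map fst es" using l by auto
  have ne: "es \<noteq> []" using l by auto
  have inc: "fst (es ! i) \<in> ends G (vs ! i) \<and> fst (es ! i) \<in> ends G (vs ! (Suc i mod ?n))"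
    if i: "i < ?n" for i
  proof -
    have "es ! i = (fst (es ! i), {vs ! i, vs ! (Suc i mod ?n)})"
      using en[OF i] sub(3) by (metis prod.collapse)
    moreover have "es ! i \<in> edges (line_graph G)" using sub(2) E i l by auto
    ultimately show ?thesis by (metis line_graph_simps(3))
  qed
  have "line_walk G ?x ?ps ?x"
    unfolding line_walk_iff_nth m
  proof (intro conjI allI impI)
    show "last (?x # map fst es) = ?x" using ne l by (simp add: last_map last_conv_nth)
    fix i assume i: "i < length ?ps"
    then show "fst (?ps ! i) \<in> edges G" using V sub(1) by auto
    show "snd (?ps ! i) \<in> ends G (fst (?ps ! i))" using inc i by simp
    show "(?x # map fst es) ! i \<in> ends G (fst (?ps ! i))"
    proof (cases i)
      case 0
      have "Suc (?n - 1) = ?n" using l by auto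
      then have "Suc (?n - 1) mod ?n = 0" by (metis mod_self)
      then show ?thesis using inc[of "?n - 1"] 0 i l by auto
    next
      case (Suc j)
      then show ?thesis using inc[of j] i l by auto
    qed
  qed
  moreover have "verts D = fst ` set ?ps" using V m by (metis list.set_map)
  \<comment> \<open>In a line circle of length 2 both line edges join the same pair; being distinct,
    they differ in their labels.\<close>
  moreover have "distinct (map snd ?ps)" if "length ?ps = 2"
  proof -
    have n: "?n = 2" using that l by simp
    have "snd (es ! 0) = snd (es ! 1)" using en[of 0] en[of 1] n sub(3) by (auto simp: insert_commute)
    moreover have "es ! 0 \<noteq> es ! 1" using d(2) n l nth_eq_iff_index_eq[of es 0 1] by auto
    ultimately have "fst (es ! 0) \<noteq> fst (es ! 1)" by (metis prod.expand)
    moreover have "es = [es ! 0, es ! 1]"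
      using n l by (intro nth_equalityI) (auto simp: less_2_cases_iff)
    ultimately have "distinct (map fst es)" by (metis distinct_length_2_or_more distinct_singleton list.simps(8) list.simps(9))
    then show ?thesis using m by simp
  qed
  ultimately show thesis using that[of ?x ?ps] m d l by simp
qed

subsection \<open>Line consistent signed graphs\<close>

lemma negative_subgraph_simps [simp]:
  "verts (negative_subgraph G \<sigma>) = verts G" "ends (negative_subgraph G \<sigma>) = ends G"
  "edges (negative_subgraph G \<sigma>) = {e \<in> edges G. \<sigma> e = -1}"
  by (auto simp: negative_subgraph_def)

lemma subgraph_negative_subgraph: "multigraph G \<Longrightarrow> subgraph (negative_subgraph G \<sigma>) G"
  by (auto simp: subgraph_def multigraph_def)

lemma negative_component:
  assumes G: "multigraph G" and H: "component H (negative_subgraph G \<sigma>)"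
  shows "subgraph H G" "multigraph H" "connected_graph H"
    and "\<And>v. v \<in> verts H \<Longrightarrow> incident_edges H v = {e \<in> incident_edges G v. \<sigma> e = -1}"
    and "\<And>e. e \<in> edges H \<Longrightarrow> \<sigma> e = -1"
proof -
  let ?N = "negative_subgraph G \<sigma>"
  have N: "multigraph ?N" using subgraph_negative_subgraph[OF G] by (simp add: subgraph_def)
  have HN: "subgraph H ?N" and "connected_graph H" using H by (auto simp: component_def)
  then show "subgraph H G" "connected_graph H"
    using subgraph_trans subgraph_negative_subgraph[OF G] by blast+
  show "multigraph H" using HN by (simp add: subgraph_def)
  show "\<sigma> e = -1" if "e \<in> edges H" for e using HN that by (auto simp: subgraph_def)
  show "incident_edges H v = {e \<in> incident_edges G v. \<sigma> e = -1}" if "v \<in> verts H" for v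
    using component_incident[OF N H that] by (auto simp: incident_edges_def)
qed

lemma cycle_length_ge_2:
  assumes "multigraph G" "cycle G v ps"
  shows "2 \<le> length ps"
proof -
  obtain e z ms f where "ps = (e, z) # ms @ [(f, v)]" using cycle_shape[OF assms] by metis
  then show ?thesis by simp
qed

lemma circle_incident_mem:
  assumes "circle_of C G" "e \<in> edges C" "v \<in> ends G e"
  shows "v \<in> verts C" "e \<in> incident_edges C v"
proof -
  have "multigraph C" "edges C \<subseteq> edges G" "ends C = ends G"
    using assms(1) by (auto simp: circle_of_def subgraph_def)
  moreover from this have "ends C e \<subseteq> verts C" using assms(2) by (simp add: multigraph_def)
  ultimately show "v \<in> verts C" "e \<in> incident_edges C v"
    using assms(2,3) by (auto simp: incident_edges_def)
qed

lemma path_edgeless_single: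
  assumes "path_graph P u w" "edges P = {}"
  shows "single_vertex P"
proof -
  obtain ps where "verts P = set (u # map snd ps)" "edges P = fst ` set ps"
    using path_graph_walk[OF assms(1)] .
  then show ?thesis using assms(2) by (auto simp: single_vertex_def)
qed

lemma connected_edge_closes_circle:
  assumes G: "multigraph G" and P: "subgraph P G" "connected_graph P"
    and e: "e \<in> edges G" "e \<notin> edges P" "ends G e \<subseteq> verts P"
  obtains C where "circle_of C G" "e \<in> edges C" "edges C \<subseteq> insert e (edges P)"
proof -
  obtain x y where xy: "ends G e = {x, y}"
    using G e(1) by (auto simp: multigraph_def card_2_iff)
  have "(x, y) \<in> (adj P)\<^sup>*" using P(2) xy e(3) by (auto simp: connected_graph_def)
  then obtain ps where ps: "walk P x ps y" "distinct (x # map snd ps)"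
    by (rule adj_imp_simple_walk)
  have sub: "fst ` set ps \<subseteq> edges P" using walk_edges[OF ps(1)] .
  have "walk G x ps y" using walk_mono[OF ps(1)] P(1) by (simp add: subgraph_def)
  moreover have "ends G e = {y, x}" using xy by auto
  moreover have "e \<notin> fst ` set ps" using e(2) sub by blast
  ultimately have "cycle G x (ps @ [(e, x)])" using ps(2) e(1) simple_walk_close by metis
  then obtain C where "circle_of C G" "edges C = fst ` set (ps @ [(e, x)])"
    using cycle_on_circle[OF G] by metis
  moreover from this sub have "edges C \<subseteq> insert e (edges P)" by auto
  ultimately show thesis using that[of C] by simp
qed

lemma negative_path_component_sym:
  "negative_path_component G \<sigma> P u w \<Longrightarrow> negative_path_component G \<sigma> P w u"
  by (auto simp: negative_path_component_def nontrivial_path_sym)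

section \<open>From line consistency to the structure conditions\<close>

locale line_consistent_signed_graph =
  fixes G :: "('v, 'e) mgraph" and \<sigma> :: "'e \<Rightarrow> int"
  assumes finite_G: "finite_multigraph G" and sign: "edge_signature G \<sigma>"
    and lc: "line_consistent G \<sigma>"
begin

lemma multigraph_G: "multigraph G"
  using finite_G by (simp add: finite_multigraph_def)

lemma sign_cases: "e \<in> incident_edges G v \<Longrightarrow> \<sigma> e = 1 \<or> \<sigma> e = -1"
  using sign by (auto simp: edge_signature_def incident_edges_def)

lemma triple_product:
  assumes "e \<in> incident_edges G v" "f \<in> incident_edges G v" "g \<in> incident_edges G v"
    "e \<noteq> f" "e \<noteq> g" "f \<noteq> g"
  shows "\<sigma> e * \<sigma> f * \<sigma> g = 1"
proof -
  \<comment> \<open>A line walk that stays at \<open>v\<close> throughout, a triangle of the line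
    graph.\<close>
  have "(\<Prod>h \<in> fst ` set [(e, v), (f, v), (g, v)]. \<sigma> h) = 1"
    using assms by (intro line_consistent_line_walk[OF lc, of v]) (auto simp: incident_edges_def)
  then show ?thesis using assms by (simp add: mult.assoc)
qed

lemma circle_line_walk:
  assumes "circle_of C G" "v \<in> verts C"
  obtains ps where "line_walk G v ps v" "distinct (map fst ps)" "distinct (map snd ps)"
    "edges C = fst ` set ps" "2 \<le> length ps"
proof -
  have C: "circle_graph C" "subgraph C G" using assms(1) by (auto simp: circle_of_def)
  obtain ps where ps: "cycle C v ps" "edges C = fst ` set ps"
    using circle_cycle[OF C(1) assms(2)] .
  have "cycle G v ps" using cycle_mono[OF ps(1) C(2)] .
  then have "walk G v ps v" "distinct (map fst ps)" "distinct (map snd ps)" "2 \<le> length ps"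
    using cycle_length_ge_2[OF multigraph_G] by (simp_all add: cycle_def)
  moreover from this have "line_walk G v ps v" by (intro walk_line_walk)
  ultimately show thesis using that[of ps] ps(2) by simp
qed

lemma balanced_G: "balanced G \<sigma>"
  unfolding balanced_def
proof (intro allI impI)
  fix C assume C: "circle_of C G"
  then obtain v where v: "v \<in> verts C" using circle_verts_nonempty by (auto simp: circle_of_def)
  obtain ps where "line_walk G v ps v" "distinct (map fst ps)" "distinct (map snd ps)"
    "edges C = fst ` set ps" "2 \<le> length ps"
    using circle_line_walk[OF C v] .
  then show "prod \<sigma> (edges C) = 1"
    using line_consistent_line_walk[OF lc, of v ps] by fastforce
qed

text \<open>Inserting \<open>e\<close> into the circle of the line graph that traverses \<open>C\<close> gives a longer circle.\<close>

lemma positive_off_circle: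
  assumes C: "circle_of C G" "v \<in> verts C" and e: "e \<in> incident_edges G v" "e \<notin> edges C"
  shows "\<sigma> e = 1"
proof -
  obtain ps where ps: "line_walk G v ps v" "distinct (map fst ps)" "distinct (map snd ps)"
    "edges C = fst ` set ps" "2 \<le> length ps"
    using circle_line_walk[OF C] .
  have "prod \<sigma> (fst ` set ((e, v) # ps)) = 1"
    using ps e by (intro line_consistent_line_walk[OF lc, of v]) (auto simp: incident_edges_def)
  moreover have "prod \<sigma> (fst ` set ((e, v) # ps)) = \<sigma> e * prod \<sigma> (edges C)"
    using ps(4) e(2) by simp
  moreover have "prod \<sigma> (edges C) = 1" using balanced_G C by (auto simp: balanced_def)
  ultimately show ?thesis by simp
qed

text \<open>A circle through \<open>e\<close> uses just one more edge at \<open>v\<close>, so it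
  misses \<open>a\<close> or \<open>b\<close>; but an edge at the circle and off it must be
  positive.\<close>

lemma negative_pair:
  assumes ab: "a \<in> incident_edges G v" "b \<in> incident_edges G v" "a \<noteq> b" "\<sigma> a = -1" "\<sigma> b = -1"
    and e: "e \<in> incident_edges G v" "e \<noteq> a" "e \<noteq> b"
  shows "\<sigma> e = 1" "isthmus G e"
proof -
  show "\<sigma> e = 1" using triple_product[of a v b e] ab e by simp
  show "isthmus G e"
    unfolding isthmus_def
  proof (intro conjI notI)
    show "e \<in> edges G" using e by (simp add: incident_edges_def)
    assume "\<exists>D. circle_of D G \<and> e \<in> edges D"
    then obtain D where D: "circle_of D G" "e \<in> edges D" by blast
    have v: "v \<in> verts D" "e \<in> incident_edges D v"
      using circle_incident_mem[OF D] e(1) by (auto simp: incident_edges_def)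
    have "circle_graph D" using D by (simp add: circle_of_def)
    then obtain p q where "incident_edges D v = {p, q}"
      using circle_incident[OF circle_of_multigraph[OF D(1)] _ v(1)] by metis
    then have "a \<notin> incident_edges D v \<or> b \<notin> incident_edges D v" using v(2) e ab(3) by auto
    then have "a \<notin> edges D \<or> b \<notin> edges D"
      using D(1) ab by (auto simp: incident_edges_def circle_of_def subgraph_def)
    then show False using positive_off_circle[OF D(1) v(1)] ab by fastforce
  qed
qed

text \<open>Two further edges would both be positive, and together with \<open>a\<close> they would
  have product -1.\<close>

lemma negative_pair_at_most_one_other:
  assumes H: "component H (negative_subgraph G \<sigma>)" "v \<in> verts H"
    and ab: "incident_edges H v = {a, b}" "a \<noteq> b"
  shows "at_most_one_other_positive_isthmus G \<sigma> H v"
proof -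
  have inc: "{e \<in> incident_edges G v. \<sigma> e = -1} = {a, b}"
    using negative_component(4)[OF multigraph_G H] ab by simp
  then have "a \<in> {e \<in> incident_edges G v. \<sigma> e = -1}" "b \<in> {e \<in> incident_edges G v. \<sigma> e = -1}"
    by simp_all
  then have ab': "a \<in> incident_edges G v" "b \<in> incident_edges G v" "\<sigma> a = -1" "\<sigma> b = -1" by auto
  have other: "e \<noteq> a \<and> e \<noteq> b" if "e \<in> incident_edges G v - edges H" for e
    using that ab(1) by (auto simp: incident_edges_def)
  have "e = f" if ef: "e \<in> incident_edges G v - edges H" "f \<in> incident_edges G v - edges H" for e f
  proof (rule ccontr)
    assume "e \<noteq> f"
    moreover have "\<sigma> e = 1" "\<sigma> f = 1"
      using negative_pair(1)[of a v b] ab' ab(2) ef other by blast+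
    ultimately show False using triple_product[of a v e f] ab' ef other by auto
  qed
  then have "card (incident_edges G v - edges H) \<le> 1"
    by (intro card_le_Suc0_iff_eq[THEN iffD2, folded One_nat_def] ballI)
      (use finite_G in \<open>auto simp: finite_multigraph_def incident_edges_def\<close>)
  then show ?thesis
    unfolding at_most_one_other_positive_isthmus_def
    using negative_pair[of a v b] ab' ab(2) other by blast
qed

text \<open>Three negative edges at a vertex have product -1, so the negative subgraph has maximum
  degree 2.\<close>

lemma negative_components: "negative_components_condition G \<sigma>"
  unfolding negative_components_condition_def
proof (intro allI impI)
  fix H assume H: "component H (negative_subgraph G \<sigma>)"
  note nc = negative_component[OF multigraph_G H]
  have fin: "finite (verts H)"
    using nc(1) finite_G by (auto simp: subgraph_def finite_multigraph_def intro: finite_subset)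
  have "e = f \<or> f = g \<or> e = g" if efg: "{e, f, g} \<subseteq> incident_edges H v" for v e f g
  proof (rule ccontr)
    assume ne: "\<not> (e = f \<or> f = g \<or> e = g)"
    have "e \<in> edges H" "v \<in> ends H e" using efg by (auto simp: incident_edges_def)
    then have "v \<in> verts H" using nc(2) by (auto simp: multigraph_def)
    then have "{e, f, g} \<subseteq> {e \<in> incident_edges G v. \<sigma> e = -1}" using efg nc(4) by simp
    then show False using triple_product[of e v f g] ne by auto
  qed
  then have "circle_graph H \<or> (\<exists>u w. path_graph H u w)"
    by (rule connected_max_degree_2[OF nc(2) fin nc(3)])
  then show "circle_graph H \<or> (\<exists>u w. nontrivial_path H u w) \<or> single_vertex H"
    using path_edgeless_single nontrivial_path_def by metis
qed

text \<open>Each vertex of the circle carries a pair of negative edges, so every edge leaving the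
  circle is an isthmus and the circle cannot be enlarged to a bigger block.\<close>

lemma circle_components: "circle_components_condition G \<sigma>"
  unfolding circle_components_condition_def
proof (intro allI impI conjI)
  fix C assume C: "component C (negative_subgraph G \<sigma>) \<and> circle_graph C"
  then have comp: "component C (negative_subgraph G \<sigma>)" and circ: "circle_graph C" by simp_all
  note nc = negative_component[OF multigraph_G comp]
  have *: "at_most_one_other_positive_isthmus G \<sigma> C v" if "v \<in> verts C" for v
    using circle_incident[OF nc(2) circ that] negative_pair_at_most_one_other[OF comp that] by metis
  then show "\<forall>v \<in> verts C. at_most_one_other_positive_isthmus G \<sigma> C v" by blast
  have "circle_of C G" using nc(1) circ by (simp add: circle_of_def)
  then show "block_of C G"
    by (rule circle_block_of[OF multigraph_G])
      (use * in \<open>auto simp: at_most_one_other_positive_isthmus_def\<close>)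
qed

text \<open>Only one edge at \<open>u\<close> is negative; two positive edges beside it would make a
  triple with product -1.\<close>

lemma path_endpoint_degree:
  assumes P: "negative_path_component G \<sigma> P u w"
  shows "degree G u \<le> 2"
proof (rule ccontr)
  assume "\<not> degree G u \<le> 2"
  have comp: "component P (negative_subgraph G \<sigma>)" and path: "nontrivial_path P u w"
    using P by (auto simp: negative_path_component_def)
  have u: "u \<in> verts P" using path nontrivial_path_start by metis
  obtain a where "incident_edges P u = {a}" using path_start_incident[OF path] .
  then have a: "{e \<in> incident_edges G u. \<sigma> e = -1} = {a}"
    using negative_component(4)[OF multigraph_G comp u] by simp
  then have a': "a \<in> incident_edges G u" "\<sigma> a = -1" by (auto simp: set_eq_iff)
  have "2 \<le> card (incident_edges G u - {a})"
    using \<open>\<not> degree G u \<le> 2\<close> a' by (simp add: degree_def card_Diff_singleton)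
  then obtain S where "S \<subseteq> incident_edges G u - {a}" "card S = 2"
    by (rule obtain_subset_with_card_n)
  then obtain e f where ef: "e \<noteq> f" "e \<in> incident_edges G u - {a}" "f \<in> incident_edges G u - {a}"
    by (auto simp: card_2_iff)
  have "\<sigma> h = 1" if "h \<in> incident_edges G u - {a}" for h
    using a that sign_cases[of h u] by auto
  then have "\<sigma> e = 1" "\<sigma> f = 1" using ef by simp_all
  then show False using triple_product[of a u e f] a' ef by auto
qed

text \<open>A negative edge touching \<open>D\<close> must belong to \<open>D\<close>. Hence the
  intersection of \<open>P\<close> and \<open>D\<close>, nonempty because of \<open>e\<close>, is
  closed in the connected graph \<open>P\<close>.\<close>

lemma negative_component_in_circle:
  assumes P: "component P (negative_subgraph G \<sigma>)" and D: "circle_of D G"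
    and e: "e \<in> edges P" "e \<in> edges D"
  shows "subgraph P D"
proof -
  note nc = negative_component[OF multigraph_G P]
  have sD: "multigraph D" "edges D \<subseteq> edges G" "ends D = ends G"
    using D by (auto simp: circle_of_def subgraph_def)
  have sP: "edges P \<subseteq> edges G" "ends P = ends G" using nc(1) by (auto simp: subgraph_def)
  let ?H = "restrict P (verts P \<inter> verts D) (edges P \<inter> edges D)"
  have in_D: "ends P f \<subseteq> verts D" if "f \<in> edges D" for f
    using multigraph_ends(1)[OF sD(1) that] sD(3) sP(2) by simp
  note in_P = multigraph_ends[OF nc(2)]
  have ne: "verts ?H \<noteq> {}" using in_P[OF e(1)] in_D[OF e(2)] by auto
  have sub: "subgraph ?H P"
  proof (rule subgraph_restrict[OF nc(2)])
    fix f assume "f \<in> edges P \<inter> edges D"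
    then show "ends P f \<subseteq> verts P \<inter> verts D" using in_P(1) in_D by blast
  qed auto
  have "?H = P"
  proof (rule closed_subgraph_eq[OF nc(2,3) sub ne])
    fix v f assume v: "v \<in> verts ?H" and f: "f \<in> incident_edges P v"
    then have "f \<in> incident_edges G v" "\<sigma> f = -1" using nc(4)[of v] by simp_all
    moreover have "v \<in> verts D" using v by simp
    ultimately have "f \<in> edges D" using positive_off_circle[OF D, of v f] by fastforce
    then show "f \<in> edges ?H" using f by (simp add: incident_edges_def)
  qed
  then have "verts P \<inter> verts D = verts P" "edges P \<inter> edges D = edges P"
    by (metis restrict_simps(1), metis restrict_simps(2))
  then show ?thesis using nc(2) sP sD by (auto simp: subgraph_def)
qed

text \<open>A further edge \<open>e\<close> with both ends on \<open>P\<close> closes a circle, so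
  it is no isthmus and cannot end at an internal vertex; it joins \<open>u\<close> and
  \<open>w\<close>. The degree bound admits no other edges at \<open>u\<close> and \<open>w\<close>,
  and those leaving internal vertices are isthmi, so \<open>P\<close> with \<open>e\<close> is a
  block.\<close>

lemma path_induced_or_circle:
  assumes P: "negative_path_component G \<sigma> P u w"
    and internal: "\<And>v. v \<in> verts P - {u, w} \<Longrightarrow> at_most_one_other_positive_isthmus G \<sigma> P v"
  shows "induced_subgraph P G \<or>
    (\<exists>C e. circle_graph C \<and> block_of C G \<and> e \<in> edges C \<and> \<sigma> e = 1 \<and> P = C\<lparr>edges := edges C - {e}\<rparr>)"
proof (cases "induced_subgraph P G")
  case False
  have comp: "component P (negative_subgraph G \<sigma>)" and path: "nontrivial_path P u w"
    using P by (auto simp: negative_path_component_def)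
  note nc = negative_component[OF multigraph_G comp]
  have sP: "edges P \<subseteq> edges G" "ends P = ends G" using nc(1) by (auto simp: subgraph_def)
  have "edges P \<noteq> {e \<in> edges G. ends G e \<subseteq> verts P}"
    using False nc(1) by (simp add: induced_subgraph_def)
  moreover have "edges P \<subseteq> {e \<in> edges G. ends G e \<subseteq> verts P}"
    using sP multigraph_ends(1)[OF nc(2)] by auto
  ultimately obtain e where e: "e \<in> edges G" "ends G e \<subseteq> verts P" "e \<notin> edges P" by blast
  obtain D where D: "circle_of D G" "e \<in> edges D"
    using connected_edge_closes_circle[OF multigraph_G nc(1,3) e(1,3,2)] .
  have "v \<in> {u, w}" if v: "v \<in> ends G e" for v
  proof (rule ccontr)
    assume "v \<notin> {u, w}"
    then have "v \<in> verts P - {u, w}" using v e(2) by auto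
    then have "at_most_one_other_positive_isthmus G \<sigma> P v" by (rule internal)
    moreover have "e \<in> incident_edges G v - edges P" using e v by (simp add: incident_edges_def)
    ultimately have "isthmus G e" by (simp add: at_most_one_other_positive_isthmus_def)
    then show False using D by (auto simp: isthmus_def)
  qed
  then have "ends G e \<subseteq> {u, w}" by blast
  moreover obtain x y where "ends G e = {x, y}" "x \<noteq> y"
    using multigraph_G e(1) by (auto simp: multigraph_def card_2_iff)
  ultimately have ends_e: "ends G e = {u, w}" by auto
  let ?C = "restrict G (verts P) (insert e (edges P))"
  \<comment> \<open>Stated for a variable endpoint \<open>v\<close>, to serve \<open>u\<close> and,
    with the path reversed, \<open>w\<close>.\<close>
  have inc_end: "incident_edges G v \<subseteq> insert e (edges P)"
    if p: "negative_path_component G \<sigma> P v v'" and v: "v \<in> ends G e" for v v'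
  proof -
    have pv: "nontrivial_path P v v'" using p by (simp add: negative_path_component_def)
    obtain a where "incident_edges P v = {a}" using path_start_incident[OF pv] .
    then have a: "a \<in> incident_edges P v" by simp
    have "degree G v \<le> 2" using path_endpoint_degree[OF p] .
    moreover have "finite (incident_edges G v)"
      using finite_G by (simp add: finite_multigraph_def incident_edges_def)
    moreover have "{a, e} \<subseteq> incident_edges G v" "a \<noteq> e"
      using a e sP v by (auto simp: incident_edges_def)
    ultimately have "{a, e} = incident_edges G v"
      by (intro card_seteq) (auto simp: degree_def)
    then have "incident_edges G v = {a, e}" by (rule sym)
    moreover have "a \<in> edges P" using a by (simp add: incident_edges_def)
    ultimately show ?thesis by simp
  qed
  have circ: "circle_of ?C G"
  proof -
    have pg: "path_graph P u w" using path by (simp add: nontrivial_path_def)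
    obtain ps where ps: "walk P u ps w" "distinct (u # map snd ps)"
      "verts P = set (u # map snd ps)" "edges P = fst ` set ps"
      using path_graph_walk[OF pg] .
    have wG: "walk G u ps w" using walk_mono[OF ps(1)] sP by simp
    have "e \<notin> fst ` set ps" "ends G e = {w, u}" using e ps(4) ends_e by auto
    then have "cycle G u (ps @ [(e, u)])" using simple_walk_close[OF wG ps(2) e(1)] by simp
    from cycle_circle[OF multigraph_G this] show ?thesis using ps(3,4) by simp
  qed
  have "block_of ?C G"
  proof (rule circle_block_of[OF multigraph_G circ])
    fix v f assume v: "v \<in> verts ?C" and f: "f \<in> incident_edges G v" "f \<notin> edges ?C"
    then have "v \<noteq> u" "v \<noteq> w"
      using inc_end[OF P] inc_end[OF negative_path_component_sym[OF P]] ends_e by auto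
    then have "v \<in> verts P - {u, w}" using v by simp
    then show "isthmus G f"
      using internal[of v] f by (auto simp: at_most_one_other_positive_isthmus_def)
  qed
  \<comment> \<open>A negative edge at \<open>u\<close> would belong to the component
    \<open>P\<close>.\<close>
  moreover have "\<sigma> e = 1"
  proof -
    have u: "u \<in> verts P" "e \<in> incident_edges G u"
      using ends_e e by (auto simp: incident_edges_def)
    have "e \<notin> incident_edges P u" using e(3) by (simp add: incident_edges_def)
    then show ?thesis using nc(4)[OF u(1)] u(2) sign_cases[OF u(2)] by auto
  qed
  moreover have "P = ?C\<lparr>edges := edges ?C - {e}\<rparr>"
    using e(3) sP by (intro mgraph_eqI) auto
  moreover have "circle_graph ?C" using circ by (simp add: circle_of_def)
  moreover have "e \<in> edges ?C" by simp
  ultimately show ?thesis by blast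
qed simp

text \<open>If one edge of \<open>P\<close> lies on a circle, all of \<open>P\<close> does, and the
  circle extends to a block. If all are isthmi, a nontrivial block at an endpoint would contain a
  circle through it, with the negative end edge of \<open>P\<close> touching that circle from
  outside.\<close>

lemma path_in_block_or_isthmi:
  assumes P: "negative_path_component G \<sigma> P u w"
  shows "in_nontrivial_block G P \<or> isthmi_away_from_blocks G P u w"
proof (cases "\<forall>e \<in> edges P. isthmus G e")
  case True
  have comp: "component P (negative_subgraph G \<sigma>)"
    using P by (auto simp: negative_path_component_def)
  note nc = negative_component[OF multigraph_G comp]
  have "v \<notin> verts B" if B: "nontrivial_block_of B G" and p: "nontrivial_path P v v'" for B v v'
  proof
    assume v: "v \<in> verts B"
    have B': "multigraph B" "block_graph B" "subgraph B G"
      using B by (auto simp: nontrivial_block_of_def block_of_def subgraph_def)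
    obtain D where D: "circle_of D B" using B by (auto simp: nontrivial_block_of_def)
    obtain C where C: "circle_of C B" "v \<in> verts C"
      using block_vertex_on_circle[OF B'(1,2) D v] .
    have CG: "circle_of C G" using circle_of_subgraph[OF C(1) B'(3)] .
    obtain a where "incident_edges P v = {a}" using path_start_incident[OF p] .
    then have a: "a \<in> incident_edges P v" by simp
    have "v \<in> verts P" using p nontrivial_path_start by metis
    then have "a \<in> incident_edges G v" "\<sigma> a = -1" using a nc(4) by auto
    moreover have "isthmus G a" using True a by (simp add: incident_edges_def)
    then have "a \<notin> edges C" using CG by (auto simp: isthmus_def)
    ultimately show False using positive_off_circle[OF CG C(2)] by auto
  qed
  moreover have "nontrivial_path P u w" "nontrivial_path P w u"
    using P nontrivial_path_sym by (auto simp: negative_path_component_def)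
  ultimately show ?thesis using True by (auto simp: isthmi_away_from_blocks_def)
next
  case False
  have comp: "component P (negative_subgraph G \<sigma>)"
    using P by (auto simp: negative_path_component_def)
  note nc = negative_component[OF multigraph_G comp]
  obtain e where e: "e \<in> edges P" "\<not> isthmus G e" using False by blast
  moreover have "e \<in> edges G" using e nc(1) by (auto simp: subgraph_def)
  ultimately obtain D where D: "circle_of D G" "e \<in> edges D" by (auto simp: isthmus_def)
  have PD: "subgraph P D" using negative_component_in_circle[OF comp D(1) e(1) D(2)] .
  have DG: "subgraph D G" "circle_graph D" using D by (auto simp: circle_of_def)
  obtain B where B: "block_of B G" "subgraph D B"
    using ex_block_of[OF finite_G DG(1) circle_of_block_graph[OF D(1)]] .
  then have "circle_of D B" using DG by (simp add: circle_of_def)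
  then have "nontrivial_block_of B G" using B by (auto simp: nontrivial_block_of_def)
  moreover have "subgraph P B" using PD B subgraph_trans by blast
  ultimately show ?thesis by (auto simp: in_nontrivial_block_def)
qed

lemma path_components: "path_components_condition G \<sigma>"
  unfolding path_components_condition_def
proof (intro allI impI)
  fix P u w assume P: "negative_path_component G \<sigma> P u w"
  have comp: "component P (negative_subgraph G \<sigma>)" and path: "path_graph P u w"
    using P by (auto simp: negative_path_component_def nontrivial_path_def)
  have internal: "at_most_one_other_positive_isthmus G \<sigma> P v" if v: "v \<in> verts P - {u, w}" for v
  proof -
    obtain a b where "a \<noteq> b" "incident_edges P v = {a, b}"
      using path_internal_incident[OF path v] .
    then show ?thesis using negative_pair_at_most_one_other[OF comp, of v a b] v by simp
  qed
  show "(induced_subgraph P G \<or>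
         (\<exists>C e. circle_graph C \<and> block_of C G \<and> e \<in> edges C \<and> \<sigma> e = 1 \<and>
                P = C\<lparr>edges := edges C - {e}\<rparr>)) \<and>
        degree G u \<le> 2 \<and> degree G w \<le> 2 \<and>
        (\<forall>v \<in> verts P - {u, w}. at_most_one_other_positive_isthmus G \<sigma> P v) \<and>
        (in_nontrivial_block G P \<or> isthmi_away_from_blocks G P u w)"
    by (intro conjI ballI path_induced_or_circle[OF P internal] path_endpoint_degree[OF P]
        path_endpoint_degree[OF negative_path_component_sym[OF P]] internal
        path_in_block_or_isthmi[OF P])
qed

end

subsection \<open>Closed trails and the converse\<close>

lemma map_snd_eq_middle:
  assumes "map snd ps = xs @ v # ys"
  obtains A e B where "ps = A @ (e, v) # B" "map snd B = ys"
proof -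
  obtain A R where R: "ps = A @ R" "map snd R = v # ys"
    using assms by (metis append_eq_map_conv)
  obtain e B where "R = (e, v) # B" "map snd B = ys" using R(2) by (cases R) auto
  then show thesis using that R(1) by blast
qed

text \<open>At a repeated vertex the trail splits into two shorter closed trails without common
  edges; without a repetition it is a circle. Both properties pass to the edge-disjoint
  union.\<close>

lemma closed_trail_balanced:
  assumes G: "multigraph G" "balanced G \<sigma>" and ps: "walk G x ps x" "distinct (map fst ps)"
  shows "prod \<sigma> (fst ` set ps) = 1 \<and> (\<forall>e \<in> fst ` set ps. \<not> isthmus G e)"
  using ps
proof (induction "length ps" arbitrary: x ps rule: less_induct)
  case less
  consider "ps = []" | "ps \<noteq> []" "distinct (map snd ps)" | "\<not> distinct (map snd ps)" by blast
  then show ?case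
  proof cases
    case 1
    then show ?thesis by simp
  next
    case 2
    then have "cycle G x ps" using less.prems by (simp add: cycle_def)
    then obtain C where C: "circle_of C G" "edges C = fst ` set ps"
      using cycle_on_circle[OF G(1)] by metis
    then have "prod \<sigma> (fst ` set ps) = 1" using G(2) by (metis balanced_def)
    moreover have "\<not> isthmus G e" if "e \<in> fst ` set ps" for e
      using C that unfolding isthmus_def by blast
    ultimately show ?thesis by blast
  next
    case 3
    obtain xs ys zs v where "map snd ps = xs @ [v] @ ys @ [v] @ zs"
      using not_distinct_decomp[OF 3] by (elim exE)
    then have "map snd ps = xs @ v # (ys @ v # zs)" by simp
    then obtain A e R where A: "ps = A @ (e, v) # R" "map snd R = ys @ v # zs"
      by (rule map_snd_eq_middle)
    obtain B f C where "R = B @ (f, v) # C" using map_snd_eq_middle[OF A(2)] .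
    then have s: "ps = A @ (e, v) # B @ (f, v) # C" using A(1) by simp
    \<comment> \<open>The inner part runs from the first visit of \<open>v\<close> to the second;
      the outer part is what remains after excising it.\<close>
    let ?I = "B @ [(f, v)]" and ?O = "A @ (e, v) # C"
    have w: "walk G v ?I v" "walk G x ?O x" using less.prems(1) unfolding s by (auto simp: walk_append)
    have d: "distinct (map fst ?I)" "distinct (map fst ?O)"
      and disj: "fst ` set ?I \<inter> fst ` set ?O = {}"
      using less.prems(2) unfolding s by auto
    have l: "length ?I < length ps" "length ?O < length ps" unfolding s by simp_all
    note IO = less.hyps[OF l(1) w(1) d(1)] less.hyps[OF l(2) w(2) d(2)]
    have U: "fst ` set ps = fst ` set ?I \<union> fst ` set ?O" unfolding s by auto
    show ?thesis
    proof
      have "prod \<sigma> (fst ` set ps) = prod \<sigma> (fst ` set ?I) * prod \<sigma> (fst ` set ?O)"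
        unfolding U by (rule prod.union_disjoint[OF _ _ disj]) simp_all
      then show "prod \<sigma> (fst ` set ps) = 1" using IO by simp
      show "\<forall>e \<in> fst ` set ps. \<not> isthmus G e" unfolding U using IO by blast
    qed
  qed
qed

fun strip :: "'v \<Rightarrow> ('e \<times> 'v) list \<Rightarrow> ('e \<times> 'v) list" where
  "strip x [] = []"
| "strip x ((e, z) # ps) = (if z = x then strip x ps else (e, z) # strip z ps)"

lemma walk_strip:
  assumes "multigraph G" "line_walk G x ps y"
  shows "walk G x (strip x ps) y"
  using assms(2)
proof (induction ps arbitrary: x)
  case Nil
  then show ?case by simp
next
  case (Cons p ps)
  obtain e z where p: "p = (e, z)" by (cases p)
  have e: "e \<in> edges G" "x \<in> ends G e" "z \<in> ends G e" "line_walk G z ps y"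
    using Cons.prems p by auto
  show ?case
  proof (cases "z = x")
    case True
    then show ?thesis using Cons.IH e p by simp
  next
    case False
    obtain u where "ends G e = {x, u}" using ends_obtain_other[OF assms(1) e(1,2)] .
    then have "ends G e = {x, z}" using e(3) False by auto
    then show ?thesis using Cons.IH e p False by simp
  qed
qed

lemma set_strip_subset: "set (strip x ps) \<subseteq> set ps"
  by (induction x ps rule: strip.induct) auto

lemma distinct_strip: "distinct (map fst ps) \<Longrightarrow> distinct (map fst (strip x ps))"
proof (induction x ps rule: strip.induct)
  case (2 x e z ps)
  then show ?case using set_strip_subset[of z ps] by auto
qed simp

text \<open>A dropped step does not move, so it sits at the start or where the last kept step ended.
  Thus every touched edge meets the trail that remains.\<close>

lemma stripped_target:
  "(e, z) \<in> set ps \<Longrightarrow> (e, z) \<notin> set (strip x ps) \<Longrightarrow> z \<in> insert x (snd ` set (strip x ps))"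
  by (induction x ps rule: strip.induct) (auto split: if_splits)

lemma line_walk_mem:
  assumes "line_walk G x ps y" "(e, z) \<in> set ps"
  shows "e \<in> incident_edges G z"
  using assms by (induction ps arbitrary: x) (auto simp: incident_edges_def)

section \<open>From the structure conditions to line consistency\<close>

locale line_structured_signed_graph =
  fixes G :: "('v, 'e) mgraph" and \<sigma> :: "'e \<Rightarrow> int"
  assumes finite_G: "finite_multigraph G" and sign: "edge_signature G \<sigma>"
    and balanced_G: "balanced G \<sigma>"
    and negative_components: "negative_components_condition G \<sigma>"
    and circle_components: "circle_components_condition G \<sigma>"
    and path_components: "path_components_condition G \<sigma>"
begin

lemma multigraph_G: "multigraph G"
  using finite_G by (simp add: finite_multigraph_def)

text \<open>With degree at least 3, \<open>v\<close> is no endpoint of a negative path, so it lies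
  on a circle component or inside a path component. There at most two edges are negative and at most
  one other exists, a positive isthmus; three edges exhaust this supply.\<close>

lemma negative_edge_among_three:
  assumes inc: "e \<in> incident_edges G v" "f \<in> incident_edges G v" "g \<in> incident_edges G v"
    and ne: "e \<noteq> f" "e \<noteq> g" "f \<noteq> g" and neg: "\<sigma> e = -1"
  shows "incident_edges G v = {e, f, g}" "\<sigma> e * \<sigma> f * \<sigma> g = 1" "isthmus G f \<or> isthmus G g"
proof -
  let ?N = "negative_subgraph G \<sigma>"
  have fin: "finite (incident_edges G v)"
    using finite_G by (simp add: finite_multigraph_def incident_edges_def)
  have N: "multigraph ?N" using subgraph_negative_subgraph[OF multigraph_G] by (simp add: subgraph_def)
  have "e \<in> edges G" "v \<in> ends G e" using inc(1) by (auto simp: incident_edges_def)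
  then have v: "v \<in> verts ?N" using multigraph_ends(1)[OF multigraph_G] by auto
  have "v \<in> verts (component_at ?N v)" using v by simp
  then obtain H where H: "component H ?N" and vH: "v \<in> verts H"
    by (rule that[OF component_component_at[OF N v]])
  note nc = negative_component[OF multigraph_G H]
  have eH: "e \<in> incident_edges H v" using nc(4)[OF vH] inc(1) neg by simp
  then have "e \<in> edges H" by (simp only: incident_edges_def mem_Collect_eq)
  then have ne_H: "edges H \<noteq> {}" by blast
  have "\<exists>a b. incident_edges H v = {a, b} \<and> at_most_one_other_positive_isthmus G \<sigma> H v"
  proof -
    have "\<not> single_vertex H" using ne_H unfolding single_vertex_def by metis
    moreover have "circle_graph H \<or> (\<exists>u w. nontrivial_path H u w) \<or> single_vertex H"
      using negative_components H unfolding negative_components_condition_def by metis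
    ultimately consider "circle_graph H" | u w where "nontrivial_path H u w" by metis
    then show ?thesis
    proof cases
      case 1
      then have "at_most_one_other_positive_isthmus G \<sigma> H v"
        using circle_components H vH unfolding circle_components_condition_def by metis
      moreover obtain a b where "incident_edges H v = {a, b}"
        using circle_incident[OF nc(2) 1 vH] .
      ultimately show ?thesis by blast
    next
      case 2
      then have "negative_path_component G \<sigma> H u w"
        using H by (simp add: negative_path_component_def)
      then have P: "degree G u \<le> 2" "degree G w \<le> 2"
        "\<forall>x \<in> verts H - {u, w}. at_most_one_other_positive_isthmus G \<sigma> H x"
        using path_components unfolding path_components_condition_def by metis+
      have "card {e, f, g} \<le> degree G v"
        unfolding degree_def using inc by (intro card_mono fin) auto
      then have "v \<noteq> u" "v \<noteq> w" using P ne by auto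
      then have v': "v \<in> verts H - {u, w}" using vH by blast
      have "path_graph H u w" using 2 by (simp add: nontrivial_path_def)
      then obtain a b where "incident_edges H v = {a, b}"
        using path_internal_incident[OF _ v'] by metis
      then show ?thesis using P(3) v' by blast
    qed
  qed
  then obtain a b where ab: "incident_edges H v = {a, b}"
    and one: "at_most_one_other_positive_isthmus G \<sigma> H v" by blast
  let ?O = "incident_edges G v - edges H"
  have "card ?O \<le> Suc 0" using one unfolding at_most_one_other_positive_isthmus_def by simp
  then have "\<forall>p \<in> ?O. \<forall>q \<in> ?O. p = q"
    using card_le_Suc0_iff_eq[of ?O] fin by blast
  then have unique: "p = q" if "p \<in> ?O" "q \<in> ?O" for p q using that by blast
  have O: "\<sigma> p = 1 \<and> isthmus G p" if "p \<in> ?O" for p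
    using one that unfolding at_most_one_other_positive_isthmus_def by blast
  have split: "p \<in> {a, b} \<or> p \<in> ?O" if "p \<in> incident_edges G v" for p
  proof (cases "p \<in> edges H")
    case True
    then have "p \<in> incident_edges H v" using that nc(4)[OF vH] nc(5) by simp
    then show ?thesis unfolding ab by blast
  qed (use that in blast)
  have neg_ab: "\<sigma> p = -1" if "p \<in> {a, b}" for p
    using that nc(4)[OF vH] unfolding ab by blast
  have e: "e \<in> {a, b}" using eH unfolding ab .
  \<comment> \<open>Which of \<open>f\<close> and \<open>g\<close> lies outside \<open>H\<close> is
    still open; \<open>p\<close> stands for that one and \<open>q\<close> for the second negative
    edge.\<close>
  have *: "incident_edges G v = {e, p, q} \<and> \<sigma> q = -1"
    if p: "p \<in> ?O" and q: "q \<in> incident_edges G v" "q \<noteq> e" "q \<noteq> p" for p q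
  proof -
    have q': "q \<in> {a, b}" using split[OF q(1)] unique[OF p] q(3) by blast
    then have "{a, b} = {e, q}" using e q(2) by auto
    then have "r \<in> {e, p, q}" if "r \<in> incident_edges G v" for r
      using split[OF that] unique[OF p] by blast
    then have "incident_edges G v \<subseteq> {e, p, q}" by (rule subsetI)
    moreover have "{e, p, q} \<subseteq> incident_edges G v" using p q inc(1) by simp
    ultimately show ?thesis using neg_ab[OF q'] by (intro conjI equalityI)
  qed
  \<comment> \<open>Three distinct edges do not fit into \<open>{a, b}\<close>.\<close>
  have "f \<in> ?O \<or> g \<in> ?O"
  proof (rule ccontr)
    assume "\<not> (f \<in> ?O \<or> g \<in> ?O)"
    then have "f \<in> {a, b}" "g \<in> {a, b}" using split inc by blast+
    then show False using e ne by auto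
  qed
  then have "incident_edges G v = {e, f, g} \<and> \<sigma> f * \<sigma> g = -1 \<and> (isthmus G f \<or> isthmus G g)"
  proof
    assume f: "f \<in> ?O"
    show ?thesis using *[OF f inc(3)] O[OF f] ne by simp
  next
    assume g: "g \<in> ?O"
    show ?thesis using *[OF g inc(2)] O[OF g] ne by auto
  qed
  then show "incident_edges G v = {e, f, g}" "\<sigma> e * \<sigma> f * \<sigma> g = 1"
    "isthmus G f \<or> isthmus G g"
    using neg by (simp_all add: mult.assoc)
qed

text \<open>A negative edge of \<open>S\<close> and two more of its edges already exhaust the edges
  at \<open>v\<close>, so \<open>S\<close> is that triple.\<close>

lemma product_at_vertex:
  assumes S: "S \<subseteq> incident_edges G v" "3 \<le> card S"
  shows "prod \<sigma> S = 1"
proof (cases "\<forall>e \<in> S. \<sigma> e = 1")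
  case True
  then show ?thesis by simp
next
  case False
  then obtain e where e: "e \<in> S" "\<sigma> e \<noteq> 1" by blast
  then have neg: "\<sigma> e = -1" using sign S(1) by (auto simp: edge_signature_def incident_edges_def)
  have "2 \<le> card (S - {e})" using S(2) e(1) by (simp add: card_Diff_singleton)
  then obtain U where "U \<subseteq> S - {e}" "card U = 2" by (rule obtain_subset_with_card_n)
  then obtain f g where fg: "f \<noteq> g" "f \<in> S - {e}" "g \<in> S - {e}" by (auto simp: card_2_iff)
  have "incident_edges G v = {e, f, g}" "\<sigma> e * \<sigma> f * \<sigma> g = 1"
    using negative_edge_among_three[of e v f g] e fg neg S(1) by blast+
  moreover from this have "S = {e, f, g}" using S(1) e fg by blast
  ultimately show ?thesis using fg by (auto simp: mult.assoc)
qed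

lemma line_consistent_G: "line_consistent G \<sigma>"
  unfolding line_consistent_def consistent_def
proof (intro allI impI)
  fix D assume D: "circle_of D (line_graph G)"
  obtain x ps where ps: "line_walk G x ps x" "distinct (map fst ps)" "verts D = fst ` set ps"
    "2 \<le> length ps" "length ps = 2 \<longrightarrow> distinct (map snd ps)"
    using line_graph_circle_walk[OF D] .
  define T where "T = strip x ps"
  have T: "walk G x T x" "distinct (map fst T)" "set T \<subseteq> set ps"
    unfolding T_def using walk_strip[OF multigraph_G ps(1)] distinct_strip[OF ps(2)] set_strip_subset
    by simp_all
  show "prod \<sigma> (verts D) = 1"
  proof (cases "T = []")
    case True
    have x: "z = x" if "(e, z) \<in> set ps" for e z
      using stripped_target[OF that, of x] True unfolding T_def by simp
    \<comment> \<open>A line circle of length 2 has two different labels, but here every label is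
      \<open>x\<close>; so at least three edges meet at \<open>x\<close>.\<close>
    have "length ps \<noteq> 2"
    proof
      assume l: "length ps = 2"
      then have "card (snd ` set ps) = 2" using ps(5) l distinct_card[of "map snd ps"] by simp
      moreover have "snd ` set ps \<subseteq> {x}" using x by auto
      then have "card (snd ` set ps) \<le> card {x}" by (intro card_mono) auto
      ultimately show False by simp
    qed
    then have "3 \<le> card (fst ` set ps)" using ps(4) distinct_card[OF ps(2)] by simp
    moreover have "fst ` set ps \<subseteq> incident_edges G x" using line_walk_mem[OF ps(1)] x by fastforce
    ultimately show ?thesis unfolding ps(3) by (intro product_at_vertex)
  next
    case False
    have trail: "prod \<sigma> (fst ` set T) = 1" "\<And>e. e \<in> fst ` set T \<Longrightarrow> \<not> isthmus G e"
      using closed_trail_balanced[OF multigraph_G balanced_G T(1,2)] by blast+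
    have "\<sigma> e = 1" if e: "e \<in> fst ` set ps - fst ` set T" for e
    proof -
      obtain z where z: "(e, z) \<in> set ps" using e by auto
      have "(e, z) \<notin> set T" using e by force
      then have "z \<in> insert x (snd ` set T)" using stripped_target[OF z] unfolding T_def by blast
      then have zT: "z \<in> snd ` set T" using walk_end_mem[OF T(1) False] by blast
      obtain as bs where ab: "T = as @ bs" "walk G z (bs @ as) z"
        using closed_walk_rotate[OF T(1) zT] .
      \<comment> \<open>Rotated to start at \<open>z\<close>, the trail shows two of its edges at
        \<open>z\<close>, the first and the last. With a negative \<open>e\<close> as third edge one
        of them would be an isthmus, contrary to \<open>trail\<close>.\<close>
      have "bs @ as \<noteq> []" using ab(1) False by auto
      then obtain p y ms q y' where pq: "bs @ as = (p, y) # ms @ [(q, z)]"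
        "ends G p = {z, y}" "ends G q = {y', z}" "p \<in> edges G" "q \<in> edges G"
        using closed_trail_shape[OF multigraph_G ab(2)] by metis
      have "distinct (map fst (bs @ as))" using T(2) ab(1) by auto
      then have ne: "p \<noteq> q" unfolding pq(1) by auto
      have "set T = set (bs @ as)" using ab(1) by auto
      then have mem: "p \<in> fst ` set T" "q \<in> fst ` set T" unfolding pq(1) by auto
      have inc: "p \<in> incident_edges G z" "q \<in> incident_edges G z"
        using pq by (simp_all add: incident_edges_def)
      have ez: "e \<in> incident_edges G z" using line_walk_mem[OF ps(1) z] .
      have "e \<noteq> p" "e \<noteq> q" using e mem by auto
      then have "\<sigma> e \<noteq> -1"
        using negative_edge_among_three(3)[OF ez inc _ _ ne] trail(2) mem by blast
      then show ?thesis using sign ez by (auto simp: edge_signature_def incident_edges_def)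
    qed
    then have "prod \<sigma> (fst ` set ps - fst ` set T) = 1" by simp
    moreover have "fst ` set T \<subseteq> fst ` set ps" using T(3) by (rule image_mono)
    ultimately show ?thesis
      unfolding ps(3) using trail(1) prod.subset_diff[of "fst ` set T" "fst ` set ps" \<sigma>] by simp
  qed
qed

end

section \<open>Consequences for the endpoints, and the theorem\<close>

lemma path_endpoint_degree_in_block:
  assumes G: "finite_multigraph G" and p: "nontrivial_path P u w" and P: "in_nontrivial_block G P"
    and deg: "degree G u \<le> 2"
  shows "degree G u = 2"
proof -
  obtain B D where B: "block_of B G" "subgraph P B" and D: "circle_of D B"
    using P by (auto simp: in_nontrivial_block_def nontrivial_block_of_def)
  have B': "multigraph B" "block_graph B" "subgraph B G"
    using B(1) by (auto simp: block_of_def subgraph_def)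
  obtain a where "incident_edges P u = {a}" using path_start_incident[OF p] .
  then have "a \<in> incident_edges P u" by simp
  then have a: "a \<in> edges B" "u \<in> ends B a"
    using B(2) by (auto simp: incident_edges_def subgraph_def)
  \<comment> \<open>The end edge of the path lies in the block, hence on a circle, which has two
    edges at \<open>u\<close>.\<close>
  obtain C where C: "circle_of C B" "a \<in> edges C"
    using block_edge_on_circle[OF B'(1,2) D a(1)] .
  have u: "u \<in> verts C" using circle_incident_mem(1)[OF C a(2)] .
  have CG: "circle_of C G" using circle_of_subgraph[OF C(1) B'(3)] .
  then have circ: "circle_graph C" by (simp add: circle_of_def)
  obtain e f where ef: "e \<noteq> f" "incident_edges C u = {e, f}"
    using circle_incident[OF circle_of_multigraph[OF CG] circ u] .
  have "incident_edges C u \<subseteq> incident_edges G u"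
    using CG by (auto simp: circle_of_def subgraph_def incident_edges_def)
  then have "card (incident_edges C u) \<le> degree G u"
    unfolding degree_def using G
    by (intro card_mono) (auto simp: finite_multigraph_def incident_edges_def)
  then show ?thesis using ef deg by simp
qed

text \<open>All negative edges at \<open>u\<close> belong to \<open>P\<close>, so \<open>e\<close>
  is positive. A circle through \<open>e\<close> would extend to a nontrivial block containing
  \<open>u\<close>.\<close>

lemma path_endpoint_other_edge:
  assumes G: "finite_multigraph G" "edge_signature G \<sigma>"
    and P: "negative_path_component G \<sigma> P u w"
    and away: "\<And>B. nontrivial_block_of B G \<Longrightarrow> u \<notin> verts B"
    and e: "e \<in> incident_edges G u" "e \<notin> edges P"
  shows "\<sigma> e = 1 \<and> isthmus G e"
proof
  have mG: "multigraph G" using G(1) by (simp add: finite_multigraph_def)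
  have eG: "e \<in> edges G" "u \<in> ends G e" using e(1) by (auto simp: incident_edges_def)
  have comp: "component P (negative_subgraph G \<sigma>)" and "u \<in> verts P"
    using P nontrivial_path_start[of P u w] by (simp_all add: negative_path_component_def)
  then have inc: "incident_edges P u = {e \<in> incident_edges G u. \<sigma> e = -1}"
    using negative_component(4)[OF mG comp] by simp
  have "e \<notin> incident_edges P u" using e(2) by (simp add: incident_edges_def)
  then show "\<sigma> e = 1" using inc e(1) G(2) eG by (auto simp: edge_signature_def)
  show "isthmus G e"
    unfolding isthmus_def
  proof (intro conjI eG(1) notI)
    assume "\<exists>D. circle_of D G \<and> e \<in> edges D"
    then obtain D where D: "circle_of D G" "e \<in> edges D" by blast
    have sD: "subgraph D G" "circle_graph D" using D(1) by (simp_all add: circle_of_def)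
    obtain B where B: "block_of B G" "subgraph D B"
      using ex_block_of[OF G(1) sD(1) circle_of_block_graph[OF D(1)]] .
    have "circle_of D B" using B(2) sD(2) by (simp add: circle_of_def)
    then have "nontrivial_block_of B G" using B(1) by (auto simp: nontrivial_block_of_def)
    moreover have "u \<in> verts B"
      using circle_incident_mem(1)[OF D eG(2)] B(2) by (auto simp: subgraph_def)
    ultimately show False using away by blast
  qed
qed

text \<open>The second conjunct makes explicit what the parentheses in (a) and (b) call necessary;
  as consequences, these claims stand beside the equivalence instead of among its
  conditions.\<close>

theorem theorem5:
  fixes \<Gamma> :: "('v, 'e) mgraph" and \<sigma> :: "'e \<Rightarrow> int"
  assumes "finite_multigraph \<Gamma>"
    and "edge_signature \<Gamma> \<sigma>"
  shows "(line_consistent \<Gamma> \<sigma> \<longleftrightarrow>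
            balanced \<Gamma> \<sigma> \<and>
            negative_components_condition \<Gamma> \<sigma> \<and>
            circle_components_condition \<Gamma> \<sigma> \<and>
            path_components_condition \<Gamma> \<sigma>) \<and>
         (\<forall>P u w. negative_path_component \<Gamma> \<sigma> P u w \<and> degree \<Gamma> u \<le> 2 \<and> degree \<Gamma> w \<le> 2 \<longrightarrow>
            (in_nontrivial_block \<Gamma> P \<longrightarrow> degree \<Gamma> u = 2 \<and> degree \<Gamma> w = 2) \<and>
            (isthmi_away_from_blocks \<Gamma> P u w \<longrightarrow>
               (\<forall>e \<in> (incident_edges \<Gamma> u \<union> incident_edges \<Gamma> w) - edges P.
                  \<sigma> e = 1 \<and> isthmus \<Gamma> e)))"
proof (intro conjI iffI allI impI)
  assume "line_consistent \<Gamma> \<sigma>"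
  then interpret line_consistent_signed_graph \<Gamma> \<sigma>
    using assms by unfold_locales
  show "balanced \<Gamma> \<sigma>" by (rule balanced_G)
  show "negative_components_condition \<Gamma> \<sigma>" by (rule negative_components)
  show "circle_components_condition \<Gamma> \<sigma>" by (rule circle_components)
  show "path_components_condition \<Gamma> \<sigma>" by (rule path_components)
next
  assume "balanced \<Gamma> \<sigma> \<and> negative_components_condition \<Gamma> \<sigma> \<and>
    circle_components_condition \<Gamma> \<sigma> \<and> path_components_condition \<Gamma> \<sigma>"
  then interpret line_structured_signed_graph \<Gamma> \<sigma>
    using assms by unfold_locales simp_all
  show "line_consistent \<Gamma> \<sigma>" by (rule line_consistent_G)
next
  fix P u w
  assume A: "negative_path_component \<Gamma> \<sigma> P u w \<and> degree \<Gamma> u \<le> 2 \<and> degree \<Gamma> w \<le> 2"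
  then have deg: "degree \<Gamma> u \<le> 2" "degree \<Gamma> w \<le> 2" by simp_all
  have P: "negative_path_component \<Gamma> \<sigma> P u w" "negative_path_component \<Gamma> \<sigma> P w u"
    using A negative_path_component_sym[of \<Gamma> \<sigma> P u w] by simp_all
  have path: "nontrivial_path P u w" "nontrivial_path P w u"
    using P by (simp_all add: negative_path_component_def)
  show "degree \<Gamma> u = 2" if "in_nontrivial_block \<Gamma> P"
    using path_endpoint_degree_in_block[OF assms(1) path(1) that deg(1)] .
  show "degree \<Gamma> w = 2" if "in_nontrivial_block \<Gamma> P"
    using path_endpoint_degree_in_block[OF assms(1) path(2) that deg(2)] .
  assume away: "isthmi_away_from_blocks \<Gamma> P u w"
  then have "u \<notin> verts B" "w \<notin> verts B" if "nontrivial_block_of B \<Gamma>" for B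
    using that unfolding isthmi_away_from_blocks_def by blast+
  then show "\<forall>e \<in> (incident_edges \<Gamma> u \<union> incident_edges \<Gamma> w) - edges P. \<sigma> e = 1 \<and> isthmus \<Gamma> e"
    using path_endpoint_other_edge[OF assms P(1)] path_endpoint_other_edge[OF assms P(2)] by blast
qed

end
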